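(* Let $R$ be a unital commutative ring, $(\mathcal B,\mathcal L,\theta,\mathcal I)$ a generalized Boolean dynamical system and $\mathcal A$ a $\mathbb Z$-graded $R$-algebra. If $f:L_R(\mathcal B,\mathcal L,\theta,\mathcal I)\to\mathcal A$ is a $\mathbb Z$-graded homomorphism of $R$-algebras, then $f$ is injective if and only if $f(rp_A)\neq0$ for all $\emptyset\neq A\in\mathcal B$ and all $0\neq r\in R$.
   Context: A generalized Boolean algebra $\mathcal B$ is a distributive lattice with relative complements and a least element $\emptyset$; write $\cup,\cap,\setminus,\subseteq$ for join, meet, relative complement and order. Morphisms preserve $\emptyset$ and all operations. An ideal is a nonempty subset closed under $\cup$ and under $\cap$ with arbitrary elements of $\mathcal B$. A generalized Boolean dynamical system $(\mathcal B,\mathcal L,\theta,\mathcal I)$ consists of a generalized Boolean algebra $\mathcal B$, a set $\mathcal L$, morphisms $\theta_\alpha:\mathcal B\to\mathcal B$ ($\alpha\in\mathcal L$), and ideals $\mathcal I_\alpha$ ($\alpha\in\mathcal L$) with $\{A\in\mathcal B:A\subseteq\theta_\alpha(B)\text{ for some }B\in\mathcal B\}\subseteq\mathcal I_\alpha$. Put $\Delta_A=\{\alpha\in\mathcal L:\theta_\alpha(A)\ne\emptyset\}$ and $\mathcal B_{\mathrm{reg}}=\{A\in\mathcal B:0<|\Delta_B|<\infty\text{ for all }\emptyset\ne B\subseteq A\}$. $L_R(\mathcal B,\mathcal L,\theta,\mathcal I)$ is the universal associative (not necessarily unital) $R$-algebra generated by $\{p_A\}_{A\in\mathcal B}\cup\{s_{\alpha,B},s_{\alpha,B}^*\}_{\alpha\in\mathcal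 L,B\in\mathcal I_\alpha}$ subject to: (1) $p_\emptyset=0$, $p_{A\cap A'}=p_Ap_{A'}$, $p_{A\cup A'}=p_A+p_{A'}-p_{A\cap A'}$; (2) $p_As_{\alpha,B}=s_{\alpha,B}p_{\theta_\alpha(A)}$ and $s_{\alpha,B}^*p_A=p_{\theta_\alpha(A)}s_{\alpha,B}^*$; (3) $s_{\alpha,B}^*s_{\alpha',B'}=\delta_{\alpha,\alpha'}p_{B\cap B'}$; (4) $s_{\alpha,B}p_{B'}=s_{\alpha,B\cap B'}$ and $p_{B'}s_{\alpha,B}^*=s_{\alpha,B\cap B'}^*$; (5) $p_A=\sum_{\alpha\in\Delta_A}s_{\alpha,\theta_\alpha(A)}s_{\alpha,\theta_\alpha(A)}^*$ for all $A\in\mathcal B_{\mathrm{reg}}$. It is $\mathbb Z$-graded with $\deg p_A=0$, $\deg s_{\alpha,A}=1$, $\deg s_{\alpha,A}^*=-1$. A homomorphism of $\mathbb Z$-graded algebras is graded if it maps degree $n$ to degree $n$ for all $n\in\mathbb Z$. *)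

theory Defs
  imports "HOL-Algebra.QuotRing" "HOL-Algebra.Module" "HOL-Library.Poly_Mapping"
begin

section \<open>Generalized Boolean dynamical systems\<close>

text \<open>
  The element \<open>x - y\<close> is the relative complement of \<open>inf x y\<close> in the interval from \<open>bot\<close> to \<open>x\<close>;
  the two axioms determine it uniquely.
\<close>

class generalized_boolean_algebra = distrib_lattice + order_bot + minus +
  assumes inf_diff_bot: "inf (x - y) y = bot"
    and sup_diff_inf: "sup (x - y) (inf x y) = x"

definition gba_morphism ::
    "('b::generalized_boolean_algebra \<Rightarrow> 'c::generalized_boolean_algebra) \<Rightarrow> bool" where
  "gba_morphism h \<longleftrightarrow> h bot = bot \<and>
     (\<forall>x y. h (sup x y) = sup (h x) (h y) \<and> h (inf x y) = inf (h x) (h y) \<and>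
            h (x - y) = h x - h y)"

definition gba_ideal :: "'b::generalized_boolean_algebra set \<Rightarrow> bool" where
  "gba_ideal J \<longleftrightarrow> J \<noteq> {} \<and> (\<forall>x\<in>J. \<forall>y\<in>J. sup x y \<in> J) \<and> (\<forall>x\<in>J. \<forall>y. inf x y \<in> J)"

text \<open>
  The label set is a set \<open>L\<close> inside a type, so that it may be empty. Only the values of
  \<open>\<theta>\<close> and \<open>\<I>\<close> on \<open>L\<close> matter.
\<close>

locale generalized_boolean_dynamical_system =
  fixes L :: "'l set"
    and \<theta> :: "'l \<Rightarrow> 'b::generalized_boolean_algebra \<Rightarrow> 'b"
    and \<I> :: "'l \<Rightarrow> 'b set"
  assumes morphism: "\<alpha> \<in> L \<Longrightarrow> gba_morphism (\<theta> \<alpha>)"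
    and ideal: "\<alpha> \<in> L \<Longrightarrow> gba_ideal (\<I> \<alpha>)"
    and range_subset: "\<alpha> \<in> L \<Longrightarrow> {A. \<exists>B. A \<le> \<theta> \<alpha> B} \<subseteq> \<I> \<alpha>"

definition Delta ::
    "'l set \<Rightarrow> ('l \<Rightarrow> 'b::generalized_boolean_algebra \<Rightarrow> 'b) \<Rightarrow> 'b \<Rightarrow> 'l set" where
  "Delta L \<theta> A = {\<alpha> \<in> L. \<theta> \<alpha> A \<noteq> bot}"

definition regular_elements ::
    "'l set \<Rightarrow> ('l \<Rightarrow> 'b::generalized_boolean_algebra \<Rightarrow> 'b) \<Rightarrow> 'b set" where
  "regular_elements L \<theta> =
     {A. \<forall>B. B \<noteq> bot \<and> B \<le> A \<longrightarrow> finite (Delta L \<theta> B) \<and> 0 < card (Delta L \<theta> B)}"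


section \<open>Associative, not necessarily unital algebras\<close>

text \<open>
  Algebras are \<^type>\<open>module\<close> records. The field \<^const>\<open>one\<close> of such a record is never used.
\<close>

locale nonunital_algebra = module R A for R (structure) and A (structure) +
  assumes mult_closed:
      "\<lbrakk>x \<in> carrier A; y \<in> carrier A\<rbrakk> \<Longrightarrow> x \<otimes>\<^bsub>A\<^esub> y \<in> carrier A"
    and mult_assoc:
      "\<lbrakk>x \<in> carrier A; y \<in> carrier A; z \<in> carrier A\<rbrakk> \<Longrightarrow>
       (x \<otimes>\<^bsub>A\<^esub> y) \<otimes>\<^bsub>A\<^esub> z = x \<otimes>\<^bsub>A\<^esub> (y \<otimes>\<^bsub>A\<^esub> z)"
    and mult_l_distr:
      "\<lbrakk>x \<in> carrier A; y \<in> carrier A; z \<in> carrier A\<rbrakk> \<Longrightarrow>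
       (x \<oplus>\<^bsub>A\<^esub> y) \<otimes>\<^bsub>A\<^esub> z = x \<otimes>\<^bsub>A\<^esub> z \<oplus>\<^bsub>A\<^esub> y \<otimes>\<^bsub>A\<^esub> z"
    and mult_r_distr:
      "\<lbrakk>x \<in> carrier A; y \<in> carrier A; z \<in> carrier A\<rbrakk> \<Longrightarrow>
       x \<otimes>\<^bsub>A\<^esub> (y \<oplus>\<^bsub>A\<^esub> z) = x \<otimes>\<^bsub>A\<^esub> y \<oplus>\<^bsub>A\<^esub> x \<otimes>\<^bsub>A\<^esub> z"
    and smult_mult_left:
      "\<lbrakk>r \<in> carrier R; x \<in> carrier A; y \<in> carrier A\<rbrakk> \<Longrightarrow>
       (r \<odot>\<^bsub>A\<^esub> x) \<otimes>\<^bsub>A\<^esub> y = r \<odot>\<^bsub>A\<^esub> (x \<otimes>\<^bsub>A\<^esub> y)"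
    and smult_mult_right:
      "\<lbrakk>r \<in> carrier R; x \<in> carrier A; y \<in> carrier A\<rbrakk> \<Longrightarrow>
       x \<otimes>\<^bsub>A\<^esub> (r \<odot>\<^bsub>A\<^esub> y) = r \<odot>\<^bsub>A\<^esub> (x \<otimes>\<^bsub>A\<^esub> y)"

text \<open>
  The second assumption says that \<open>A\<close> is the direct sum of the submodules \<open>G n\<close>.
\<close>

locale Z_graded_algebra = nonunital_algebra R A
    for R (structure) and A (structure) and G :: "int \<Rightarrow> _ set" +
  assumes graded_submodule: "submodule (G n) R A"
    and graded_decomposition:
      "x \<in> carrier A \<Longrightarrow>
       \<exists>!c. (\<forall>n. c n \<in> G n) \<and> finite {n. c n \<noteq> \<zero>\<^bsub>A\<^esub>} \<and>
            x = (\<Oplus>\<^bsub>A\<^esub>n\<in>{n. c n \<noteq> \<zero>\<^bsub>A\<^esub>}. c n)"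
    and graded_mult:
      "\<lbrakk>x \<in> G m; y \<in> G n\<rbrakk> \<Longrightarrow> x \<otimes>\<^bsub>A\<^esub> y \<in> G (m + n)"

definition algebra_hom ::
    "('r, 'm) ring_scheme \<Rightarrow> ('r, 'a) module \<Rightarrow> ('r, 'c) module \<Rightarrow> ('a \<Rightarrow> 'c) \<Rightarrow> bool" where
  "algebra_hom R A B f \<longleftrightarrow>
     f \<in> carrier A \<rightarrow> carrier B \<and>
     (\<forall>x\<in>carrier A. \<forall>y\<in>carrier A. f (x \<oplus>\<^bsub>A\<^esub> y) = f x \<oplus>\<^bsub>B\<^esub> f y) \<and>
     (\<forall>x\<in>carrier A. \<forall>y\<in>carrier A. f (x \<otimes>\<^bsub>A\<^esub> y) = f x \<otimes>\<^bsub>B\<^esub> f y) \<and>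
     (\<forall>r\<in>carrier R. \<forall>x\<in>carrier A. f (r \<odot>\<^bsub>A\<^esub> x) = r \<odot>\<^bsub>B\<^esub> f x)"

definition Z_graded_hom ::
    "('r, 'm) ring_scheme \<Rightarrow> ('r, 'a) module \<Rightarrow> (int \<Rightarrow> 'a set) \<Rightarrow>
     ('r, 'c) module \<Rightarrow> (int \<Rightarrow> 'c set) \<Rightarrow> ('a \<Rightarrow> 'c) \<Rightarrow> bool" where
  "Z_graded_hom R A G B H f \<longleftrightarrow> algebra_hom R A B f \<and> (\<forall>n. f ` G n \<subseteq> H n)"

definition algebra_ideal ::
    "('r, 'm) ring_scheme \<Rightarrow> ('r, 'a) module \<Rightarrow> 'a set \<Rightarrow> bool" where
  "algebra_ideal R A J \<longleftrightarrow> submodule J R A \<and>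
     (\<forall>a\<in>carrier A. \<forall>x\<in>J. a \<otimes>\<^bsub>A\<^esub> x \<in> J \<and> x \<otimes>\<^bsub>A\<^esub> a \<in> J)"

definition algebra_genideal ::
    "('r, 'm) ring_scheme \<Rightarrow> ('r, 'a) module \<Rightarrow> 'a set \<Rightarrow> 'a set" where
  "algebra_genideal R A S = \<Inter>{J. algebra_ideal R A J \<and> S \<subseteq> J}"

text \<open>The same construction as \<^const>\<open>FactRing\<close>, with scalar multiplication added.\<close>

definition quotient_algebra :: "('r, 'a) module \<Rightarrow> 'a set \<Rightarrow> ('r, 'a set) module" where
  "quotient_algebra A J =
     \<lparr>carrier = a_rcosets\<^bsub>A\<^esub> J, monoid.mult = rcoset_mult A J, one = undefined,
      ring.zero = J, add = set_add A,
      smult = (\<lambda>r C. \<Union>x\<in>C. J +>\<^bsub>A\<^esub> (r \<odot>\<^bsub>A\<^esub> x))\<rparr>"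


section \<open>Free algebras\<close>

datatype 'g free_word = Word (letters: "'g list")

instantiation free_word :: (type) monoid_add
begin

definition zero_free_word :: "'a free_word" where
  "0 = Word []"

definition plus_free_word :: "'a free_word \<Rightarrow> 'a free_word \<Rightarrow> 'a free_word" where
  "v + w = Word (letters v @ letters w)"

instance
  by standard (simp_all add: zero_free_word_def plus_free_word_def)

end

text \<open>
  The scalars form a commutative ring with unit given by type classes. The sort
  \<open>{comm_ring, comm_monoid_mult}\<close> is used rather than \<^class>\<open>comm_ring_1\<close>
  because the latter excludes the zero ring.
\<close>

definition scalars :: "'r::{comm_ring, comm_monoid_mult} ring" where
  "scalars = \<lparr>carrier = UNIV, monoid.mult = (*), one = 1, ring.zero = 0, add = (+)\<rparr>"

text \<open>
  Multiplication of finitely supported functions on words is convolution with respect to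
  concatenation. Leaving out the empty word makes this the free non-unital algebra on \<open>X\<close>.
\<close>

definition free_algebra ::
    "'g set \<Rightarrow> ('r::{comm_ring, comm_monoid_mult}, 'g free_word \<Rightarrow>\<^sub>0 'r) module" where
  "free_algebra X =
     \<lparr>carrier = {x. \<forall>w\<in>Poly_Mapping.keys x. letters w \<noteq> [] \<and> set (letters w) \<subseteq> X},
      monoid.mult = (*), one = undefined, ring.zero = 0, add = (+),
      smult = (\<lambda>r. Poly_Mapping.map ((*) r))\<rparr>"

definition free_gen :: "'g \<Rightarrow> 'g free_word \<Rightarrow>\<^sub>0 'r::{comm_ring, comm_monoid_mult}" where
  "free_gen g = Poly_Mapping.single (Word [g]) 1"


section \<open>The algebra of a generalized Boolean dynamical system\<close>

datatype ('l, 'b) gbds_gen = Gen_p 'b | Gen_s 'l 'b | Gen_s_star 'l 'b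

definition gbds_gens :: "'l set \<Rightarrow> ('l \<Rightarrow> 'b set) \<Rightarrow> ('l, 'b) gbds_gen set" where
  "gbds_gens L \<I> = range Gen_p \<union>
     {Gen_s \<alpha> B |\<alpha> B. \<alpha> \<in> L \<and> B \<in> \<I> \<alpha>} \<union> {Gen_s_star \<alpha> B |\<alpha> B. \<alpha> \<in> L \<and> B \<in> \<I> \<alpha>}"

type_synonym ('l, 'b, 'r) gbds_free = "('l, 'b) gbds_gen free_word \<Rightarrow>\<^sub>0 'r"

abbreviation free_p :: "'b \<Rightarrow> ('l, 'b, 'r::{comm_ring, comm_monoid_mult}) gbds_free" where
  "free_p A \<equiv> free_gen (Gen_p A)"

abbreviation free_s :: "'l \<Rightarrow> 'b \<Rightarrow> ('l, 'b, 'r::{comm_ring, comm_monoid_mult}) gbds_free" where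
  "free_s \<alpha> B \<equiv> free_gen (Gen_s \<alpha> B)"

abbreviation free_s_star ::
    "'l \<Rightarrow> 'b \<Rightarrow> ('l, 'b, 'r::{comm_ring, comm_monoid_mult}) gbds_free" where
  "free_s_star \<alpha> B \<equiv> free_gen (Gen_s_star \<alpha> B)"

inductive gbds_rel ::
    "'l set \<Rightarrow> ('l \<Rightarrow> 'b::generalized_boolean_algebra \<Rightarrow> 'b) \<Rightarrow> ('l \<Rightarrow> 'b set) \<Rightarrow>
     ('l, 'b, 'r::{comm_ring, comm_monoid_mult}) gbds_free \<Rightarrow> ('l, 'b, 'r) gbds_free \<Rightarrow> bool"
  for L \<theta> \<I>
where
  p_bot: "gbds_rel L \<theta> \<I> (free_p bot) 0"
| p_inf: "gbds_rel L \<theta> \<I> (free_p (inf A A')) (free_p A * free_p A')"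
| p_sup: "gbds_rel L \<theta> \<I> (free_p (sup A A')) (free_p A + free_p A' - free_p (inf A A'))"
| p_s: "\<lbrakk>\<alpha> \<in> L; B \<in> \<I> \<alpha>\<rbrakk> \<Longrightarrow>
    gbds_rel L \<theta> \<I> (free_p A * free_s \<alpha> B) (free_s \<alpha> B * free_p (\<theta> \<alpha> A))"
| s_star_p: "\<lbrakk>\<alpha> \<in> L; B \<in> \<I> \<alpha>\<rbrakk> \<Longrightarrow>
    gbds_rel L \<theta> \<I> (free_s_star \<alpha> B * free_p A) (free_p (\<theta> \<alpha> A) * free_s_star \<alpha> B)"
| s_star_s: "\<lbrakk>\<alpha> \<in> L; B \<in> \<I> \<alpha>; \<alpha>' \<in> L; B' \<in> \<I> \<alpha>'\<rbrakk> \<Longrightarrow>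
    gbds_rel L \<theta> \<I> (free_s_star \<alpha> B * free_s \<alpha>' B')
      (if \<alpha> = \<alpha>' then free_p (inf B B') else 0)"
| s_p: "\<lbrakk>\<alpha> \<in> L; B \<in> \<I> \<alpha>\<rbrakk> \<Longrightarrow>
    gbds_rel L \<theta> \<I> (free_s \<alpha> B * free_p B') (free_s \<alpha> (inf B B'))"
| p_s_star: "\<lbrakk>\<alpha> \<in> L; B \<in> \<I> \<alpha>\<rbrakk> \<Longrightarrow>
    gbds_rel L \<theta> \<I> (free_p B' * free_s_star \<alpha> B) (free_s_star \<alpha> (inf B B'))"
| p_regular: "A \<in> regular_elements L \<theta> \<Longrightarrow>
    gbds_rel L \<theta> \<I> (free_p A)
      (\<Sum>\<alpha>\<in>Delta L \<theta> A. free_s \<alpha> (\<theta> \<alpha> A) * free_s_star \<alpha> (\<theta> \<alpha> A))"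

definition gbds_relation_ideal ::
    "'l set \<Rightarrow> ('l \<Rightarrow> 'b::generalized_boolean_algebra \<Rightarrow> 'b) \<Rightarrow> ('l \<Rightarrow> 'b set) \<Rightarrow>
     ('l, 'b, 'r::{comm_ring, comm_monoid_mult}) gbds_free set" where
  "gbds_relation_ideal L \<theta> \<I> =
     algebra_genideal scalars (free_algebra (gbds_gens L \<I>)) {x - y |x y. gbds_rel L \<theta> \<I> x y}"

definition gbds_algebra ::
    "'l set \<Rightarrow> ('l \<Rightarrow> 'b::generalized_boolean_algebra \<Rightarrow> 'b) \<Rightarrow> ('l \<Rightarrow> 'b set) \<Rightarrow>
     ('r::{comm_ring, comm_monoid_mult}, ('l, 'b, 'r) gbds_free set) module" where
  "gbds_algebra L \<theta> \<I> =
     quotient_algebra (free_algebra (gbds_gens L \<I>)) (gbds_relation_ideal L \<theta> \<I>)"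

definition gbds_class ::
    "'l set \<Rightarrow> ('l \<Rightarrow> 'b::generalized_boolean_algebra \<Rightarrow> 'b) \<Rightarrow> ('l \<Rightarrow> 'b set) \<Rightarrow>
     ('l, 'b, 'r::{comm_ring, comm_monoid_mult}) gbds_free \<Rightarrow> ('l, 'b, 'r) gbds_free set" where
  "gbds_class L \<theta> \<I> x =
     gbds_relation_ideal L \<theta> \<I> +>\<^bsub>free_algebra (gbds_gens L \<I>)\<^esub> x"

definition gbds_p ::
    "'l set \<Rightarrow> ('l \<Rightarrow> 'b::generalized_boolean_algebra \<Rightarrow> 'b) \<Rightarrow> ('l \<Rightarrow> 'b set) \<Rightarrow> 'b \<Rightarrow>
     ('l, 'b, 'r::{comm_ring, comm_monoid_mult}) gbds_free set" where
  "gbds_p L \<theta> \<I> A = gbds_class L \<theta> \<I> (free_p A)"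

fun gen_degree :: "('l, 'b) gbds_gen \<Rightarrow> int" where
  "gen_degree (Gen_p A) = 0"
| "gen_degree (Gen_s \<alpha> B) = 1"
| "gen_degree (Gen_s_star \<alpha> B) = -1"

definition word_degree :: "('l, 'b) gbds_gen free_word \<Rightarrow> int" where
  "word_degree w = sum_list (map gen_degree (letters w))"

definition gbds_grading ::
    "'l set \<Rightarrow> ('l \<Rightarrow> 'b::generalized_boolean_algebra \<Rightarrow> 'b) \<Rightarrow> ('l \<Rightarrow> 'b set) \<Rightarrow>
     int \<Rightarrow> ('l, 'b, 'r::{comm_ring, comm_monoid_mult}) gbds_free set set" where
  "gbds_grading L \<theta> \<I> n =
     gbds_class L \<theta> \<I> `
       {x \<in> carrier (free_algebra (gbds_gens L \<I>)). \<forall>w\<in>Poly_Mapping.keys x. word_degree w = n}"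

end

theory Submission
  imports Defs
begin

text \<open>
  The kernel of \<open>f\<close> pulls back to a graded ideal \<open>K\<close> of the free algebra containing the ideal \<open>J\<close>
  generated by the relations, so the theorem amounts to two statements:
  no \<open>r p\<^sub>A\<close> with \<open>r \<noteq> 0\<close> and \<open>A \<noteq> \<emptyset>\<close> lies in \<open>J\<close> (\<open>scaled_p_not_mem_rel_ideal\<close>), and if no such
  \<open>r p\<^sub>A\<close> lies in \<open>K\<close>, then every homogeneous element of \<open>K\<close> lies in \<open>J\<close>
  (\<open>homogeneous_mem_J\<close>).

  For the second statement, every element of degree \<open>n\<close> is, modulo \<open>J\<close>, a sum of monomials
  \<open>s\<^sub>1 \<dots> s\<^sub>i (r p\<^sub>A) t\<^sub>j \<dots> t\<^sub>1\<close> with \<open>i - j = n\<close>, where \<open>s\<close> and \<open>t\<close> stand for the generators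
  \<open>s\<^sub>\<alpha>\<^sub>,\<^sub>B\<close> and their adjoints. An element that is a sum of products starting with some \<open>s\<close> is
  zero as soon as all its left multiples by a \<open>t\<close> are zero (\<open>left_detect\<close>). For \<open>n > 0\<close> these
  multiples have degree \<open>n - 1\<close>, and induction applies; the case \<open>n < 0\<close> is dual. In degree 0 the
  induction is on the largest number \<open>N\<close> of letters \<open>s\<close> in the monomials. Write \<open>x \<in> K\<close> as
  \<open>\<Sum> r p\<^sub>A + \<Sum> s y t\<close> with pairwise disjoint \<open>A\<close>. If some \<open>A\<close> with \<open>r \<noteq> 0\<close> were not regular,
  there would be \<open>\<emptyset> \<noteq> B \<subseteq> A\<close> with \<open>\<Delta>\<^sub>B\<close> empty or infinite. In the first case \<open>p\<^sub>B x = r p\<^sub>B\<close>; in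
  the second case a label \<open>\<alpha> \<in> \<Delta>\<^sub>B\<close> that starts no \<open>s y t\<close> gives \<open>t p\<^sub>B x s = r p\<^sub>D\<close> for
  \<open>D = \<theta>\<^sub>\<alpha>(B)\<close>. Either way \<open>K\<close> contains a forbidden element (\<open>regular_of_mem\<close>). So each \<open>r p\<^sub>A\<close>
  expands by the relation for regular elements, \<open>x\<close> is a sum of products \<open>s y t\<close>, and \<open>x\<close> vanishes
  because all \<open>t x s\<close> do, by induction. For \<open>N = 0\<close> already \<open>p\<^sub>A x = r p\<^sub>A\<close> shows that each
  \<open>r p\<^sub>A\<close> vanishes.

  For the first statement, consider the pairs \<open>(\<chi>, k)\<close> of a character (prime filter) \<open>\<chi>\<close> of the
  generalized Boolean algebra and an element \<open>k\<close> of a fixed infinite set that is at least as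
  large as the set of edges \<open>(\<alpha>, \<chi>)\<close>, the edge \<open>(\<alpha>, \<chi>)\<close> running from \<open>\<chi>\<close> to \<open>\<chi> \<circ> \<theta>\<^sub>\<alpha>\<close>. By
  cardinality, the copies of the fixed set over the sources of the edges into a given character,
  if there are any, can be glued bijectively to the copy over that character. The generators then
  act on the scalar functions on the set of these pairs. The relation for regular elements holds
  because a character that contains a regular element receives an edge
  (\<open>regular_character_has_edge\<close>), and \<open>r p\<^sub>A\<close> acts nontrivially because some character
  contains \<open>A\<close>.
\<close>

section \<open>Generalized Boolean algebras\<close>

context generalized_boolean_algebra
begin

subclass bounded_lattice_bot ..

lemma diff_le: "x - y \<le> x"
  by (metis sup_diff_inf sup.cobounded1)

end

lemma inf_bot_mono: "inf A D = bot \<Longrightarrow> B \<le> A \<Longrightarrow> inf B D = (bot::'b::generalized_boolean_algebra)"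
  by (metis bot.extremum_uniqueI inf_mono order_refl)

text \<open>
  Rewrites the formal sum \<open>r p\<^sub>A + \<Sum> r' p\<^sub>D\<close>, where the pairs \<open>(r', D)\<close> run through a list with pairwise
  disjoint second components, as a formal sum of the same kind: the first \<open>D\<close> is cut into
  \<open>D \<inter> A\<close> and \<open>D - A\<close>, and \<open>A - D\<close> is passed on to the rest of the list.
\<close>

fun refine :: "'r::plus \<Rightarrow> 'b::generalized_boolean_algebra \<Rightarrow> ('r \<times> 'b) list \<Rightarrow> ('r \<times> 'b) list" where
  "refine r A [] = [(r, A)]"
| "refine r A ((r', D) # ys) = (r + r', inf D A) # (r', D - A) # refine r (A - D) ys"

abbreviation disjoint_list :: "('r \<times> 'b::generalized_boolean_algebra) list \<Rightarrow> bool" where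
  "disjoint_list \<equiv> sorted_wrt (\<lambda>x y. inf (snd x) (snd y) = bot)"

lemma refine_disjoint:
  assumes "inf A D = bot" and "\<And>x. x \<in> set ys \<Longrightarrow> inf (snd x) D = bot" and "x \<in> set (refine r A ys)"
  shows "inf (snd x) D = bot"
  using assms
proof (induction r A ys rule: refine.induct)
  case (2 r A r' D' ys)
  have D': "inf D' D = bot" using 2(3)[of "(r', D')"] by simp
  consider "x = (r + r', inf D' A)" | "x = (r', D' - A)" | "x \<in> set (refine r (A - D') ys)"
    using 2(4) by auto
  then show ?case
  proof cases
    case 3
    then show ?thesis using 2 inf_bot_mono[OF 2(2) diff_le] by simp
  qed (use inf_bot_mono[OF D'] diff_le in auto)
qed auto

lemma disjoint_list_refine: "disjoint_list ys \<Longrightarrow> disjoint_list (refine r A ys)"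
proof (induction r A ys rule: refine.induct)
  case (2 r A r' D ys)
  have *: "inf (snd x) D = bot" if "x \<in> set (refine r (A - D) ys)" for x
  proof (rule refine_disjoint[OF inf_diff_bot _ that])
    show "inf (snd y) D = bot" if "y \<in> set ys" for y
      using that 2(2) by (simp add: inf.commute)
  qed
  have "inf (inf D A) (D - A) = bot"
    by (metis inf.assoc inf.commute inf_bot_left inf_diff_bot)
  moreover have "inf (inf D A) (snd x) = bot" "inf (D - A) (snd x) = bot"
    if "x \<in> set (refine r (A - D) ys)" for x
    using *[OF that] inf_bot_mono[of D "snd x" "inf D A"] inf_bot_mono[of D "snd x" "D - A"]
    by (auto simp: inf.commute diff_le)
  ultimately show ?case using 2 by auto
qed auto

section \<open>Monomials modulo the relations\<close>

context generalized_boolean_dynamical_system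
begin

lemma theta_bot: "\<alpha> \<in> L \<Longrightarrow> \<theta> \<alpha> bot = bot"
  and theta_sup: "\<alpha> \<in> L \<Longrightarrow> \<theta> \<alpha> (sup A A') = sup (\<theta> \<alpha> A) (\<theta> \<alpha> A')"
  and theta_inf: "\<alpha> \<in> L \<Longrightarrow> \<theta> \<alpha> (inf A A') = inf (\<theta> \<alpha> A) (\<theta> \<alpha> A')"
  using morphism unfolding gba_morphism_def by blast+

lemma inf_mem_ideal: "\<alpha> \<in> L \<Longrightarrow> B \<in> \<I> \<alpha> \<Longrightarrow> inf B B' \<in> \<I> \<alpha>"
  using ideal unfolding gba_ideal_def by blast

lemma theta_ideal: "\<alpha> \<in> L \<Longrightarrow> \<theta> \<alpha> A \<in> \<I> \<alpha>"
  using range_subset by blast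

end

text \<open>
  A subalgebra \<open>C\<close> of a ring, an ideal \<open>J\<close> of \<open>C\<close>, and elements \<open>q r A\<close> (to be thought of as \<open>r p\<^sub>A\<close>),
  \<open>s \<alpha> B\<close> and \<open>t \<alpha> B\<close> (the adjoint of \<open>s \<alpha> B\<close>) of \<open>C\<close> that satisfy the defining relations modulo \<open>J\<close>.
  Working modulo \<open>J\<close>, rather than with cosets, keeps the arithmetic inside a ring type.
\<close>

locale gbds_congruence = generalized_boolean_dynamical_system L \<theta> \<I>
    for L :: "'l set"
      and \<theta> :: "'l \<Rightarrow> 'b::generalized_boolean_algebra \<Rightarrow> 'b"
      and \<I> :: "'l \<Rightarrow> 'b set" +
  fixes C J :: "'x::ring set"
    and q :: "'r::{comm_ring, comm_monoid_mult} \<Rightarrow> 'b \<Rightarrow> 'x"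
    and s t :: "'l \<Rightarrow> 'b \<Rightarrow> 'x"
  assumes C_add: "\<lbrakk>x \<in> C; y \<in> C\<rbrakk> \<Longrightarrow> x + y \<in> C"
    and C_diff: "\<lbrakk>x \<in> C; y \<in> C\<rbrakk> \<Longrightarrow> x - y \<in> C"
    and C_mult: "\<lbrakk>x \<in> C; y \<in> C\<rbrakk> \<Longrightarrow> x * y \<in> C"
    and q_C: "q r A \<in> C"
    and s_C: "\<lbrakk>\<alpha> \<in> L; B \<in> \<I> \<alpha>\<rbrakk> \<Longrightarrow> s \<alpha> B \<in> C"
    and t_C: "\<lbrakk>\<alpha> \<in> L; B \<in> \<I> \<alpha>\<rbrakk> \<Longrightarrow> t \<alpha> B \<in> C"
    and J_sub: "J \<subseteq> C"
    and J_zero: "0 \<in> J"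
    and J_add: "\<lbrakk>x \<in> J; y \<in> J\<rbrakk> \<Longrightarrow> x + y \<in> J"
    and J_diff: "\<lbrakk>x \<in> J; y \<in> J\<rbrakk> \<Longrightarrow> x - y \<in> J"
    and J_left: "\<lbrakk>z \<in> C; x \<in> J\<rbrakk> \<Longrightarrow> z * x \<in> J"
    and J_right: "\<lbrakk>z \<in> C; x \<in> J\<rbrakk> \<Longrightarrow> x * z \<in> J"
    and q_zero: "q 0 A = 0"
    and q_add: "q (r + r') A = q r A + q r' A"
    and q_bot: "q r bot \<in> J"
    and q_inf: "q r A * q r' A' - q (r * r') (inf A A') \<in> J"
    and q_sup: "q r (sup A A') - (q r A + q r A' - q r (inf A A')) \<in> J"
    and q_s: "\<lbrakk>\<alpha> \<in> L; B \<in> \<I> \<alpha>\<rbrakk> \<Longrightarrow> q r A * s \<alpha> B - s \<alpha> B * q r (\<theta> \<alpha> A) \<in> J"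
    and t_q: "\<lbrakk>\<alpha> \<in> L; B \<in> \<I> \<alpha>\<rbrakk> \<Longrightarrow> t \<alpha> B * q r A - q r (\<theta> \<alpha> A) * t \<alpha> B \<in> J"
    and t_s_same: "\<lbrakk>\<alpha> \<in> L; B \<in> \<I> \<alpha>; B' \<in> \<I> \<alpha>\<rbrakk> \<Longrightarrow> t \<alpha> B * s \<alpha> B' - q 1 (inf B B') \<in> J"
    and t_s_diff: "\<lbrakk>\<alpha> \<in> L; B \<in> \<I> \<alpha>; \<alpha>' \<in> L; B' \<in> \<I> \<alpha>'; \<alpha> \<noteq> \<alpha>'\<rbrakk> \<Longrightarrow> t \<alpha> B * s \<alpha>' B' \<in> J"
    and s_q: "\<lbrakk>\<alpha> \<in> L; B \<in> \<I> \<alpha>\<rbrakk> \<Longrightarrow> s \<alpha> B * q 1 B' - s \<alpha> (inf B B') \<in> J"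
    and q_t: "\<lbrakk>\<alpha> \<in> L; B \<in> \<I> \<alpha>\<rbrakk> \<Longrightarrow> q 1 B' * t \<alpha> B - t \<alpha> (inf B B') \<in> J"
    and q_regular: "A \<in> regular_elements L \<theta> \<Longrightarrow>
      q 1 A - (\<Sum>\<alpha>\<in>Delta L \<theta> A. s \<alpha> (\<theta> \<alpha> A) * t \<alpha> (\<theta> \<alpha> A)) \<in> J"
begin

lemmas closed = C_add C_diff C_mult q_C s_C t_C

text \<open>Congruence modulo \<open>J\<close>.\<close>

definition cong (infix "\<approx>" 50) where "x \<approx> y \<longleftrightarrow> x - y \<in> J"

lemma cong_refl: "x \<approx> x"
  by (simp add: cong_def J_zero)

lemma cong_sym: "x \<approx> y \<Longrightarrow> y \<approx> x"
  unfolding cong_def by (metis J_diff J_zero diff_0 minus_diff_eq)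

lemma cong_trans [trans]: "x \<approx> y \<Longrightarrow> y \<approx> z \<Longrightarrow> x \<approx> z"
  unfolding cong_def by (drule (1) J_add) simp

lemma cong_add: "x \<approx> x' \<Longrightarrow> y \<approx> y' \<Longrightarrow> x + y \<approx> x' + y'"
  unfolding cong_def by (drule (1) J_add) (simp add: algebra_simps)

lemma cong_diff: "x \<approx> x' \<Longrightarrow> y \<approx> y' \<Longrightarrow> x - y \<approx> x' - y'"
  unfolding cong_def by (drule (1) J_diff) (simp add: algebra_simps)

lemma cong_left: "y \<approx> y' \<Longrightarrow> x \<in> C \<Longrightarrow> x * y \<approx> x * y'"
  unfolding cong_def by (drule (1) J_left[rotated]) (simp add: algebra_simps)

lemma cong_right: "y \<approx> y' \<Longrightarrow> x \<in> C \<Longrightarrow> y * x \<approx> y' * x"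
  unfolding cong_def by (drule (1) J_right[rotated]) (simp add: algebra_simps)

lemma cong_zero: "x \<approx> 0 \<longleftrightarrow> x \<in> J"
  by (simp add: cong_def)

lemma cong_J: "x \<approx> y \<Longrightarrow> y \<in> J \<Longrightarrow> x \<in> J"
  using cong_trans cong_zero by blast

lemma C_zero: "0 \<in> C"
  using J_sub J_zero by blast

lemma cong_sum_list:
  "(\<And>i. i \<in> set xs \<Longrightarrow> g i \<approx> h i) \<Longrightarrow> sum_list (map g xs) \<approx> sum_list (map h xs)"
  by (induction xs) (auto simp: cong_refl cong_add)

lemma J_sum_list: "(\<And>i. i \<in> set xs \<Longrightarrow> g i \<in> J) \<Longrightarrow> sum_list (map g xs) \<in> J"
  by (induction xs) (auto simp: J_zero J_add)

lemmas s_q' = s_q[folded cong_def] and q_t' = q_t[folded cong_def] and q_s' = q_s[folded cong_def]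
  and t_q' = t_q[folded cong_def] and q_inf' = q_inf[folded cong_def]
  and t_s' = t_s_same[folded cong_def]

lemma s_q_same: "\<alpha> \<in> L \<Longrightarrow> B \<in> \<I> \<alpha> \<Longrightarrow> s \<alpha> B * q 1 B \<approx> s \<alpha> B"
  using s_q'[of \<alpha> B B] by simp

lemma q_t_same: "\<alpha> \<in> L \<Longrightarrow> B \<in> \<I> \<alpha> \<Longrightarrow> q 1 B * t \<alpha> B \<approx> t \<alpha> B"
  using q_t'[of \<alpha> B B] by simp

lemma q_diff: "q r (A - D) + q r (inf A D) \<approx> q r A"
proof -
  have "q r (sup (A - D) (inf A D)) \<approx> q r (A - D) + q r (inf A D) - q r (inf (A - D) (inf A D))"
    using q_sup by (simp add: cong_def)
  moreover have "inf (A - D) (inf A D) = bot"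
    by (metis inf.assoc inf.commute inf_bot_left inf_diff_bot)
  ultimately have "q r A \<approx> q r (A - D) + q r (inf A D) - q r bot"
    by (simp add: sup_diff_inf)
  also have "\<dots> \<approx> q r (A - D) + q r (inf A D) - 0"
    by (intro cong_diff cong_refl) (simp add: cong_zero q_bot)
  finally show ?thesis by (simp add: cong_sym)
qed

lemma q_disjoint: "inf A B = bot \<Longrightarrow> q r A * q r' B \<in> J"
  using q_inf'[of r A r' B] q_bot cong_J by metis

lemma q_s_bot: "\<alpha> \<in> L \<Longrightarrow> B \<in> \<I> \<alpha> \<Longrightarrow> \<theta> \<alpha> A = bot \<Longrightarrow> q r A * s \<alpha> B \<in> J"
  using cong_J[OF q_s'[of \<alpha> B r A]] J_left[OF s_C q_bot] by simp

subsection \<open>Monomials\<close>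

text \<open>
  Products of \<open>i\<close> elements \<open>s\<close>, one element \<open>q\<close> and \<open>j\<close> elements \<open>t\<close>, in this order. Zero is admitted for
  all \<open>i\<close> and \<open>j\<close>, so that multiplying by a generator gives a monomial again modulo \<open>J\<close>.
\<close>

inductive monomial :: "nat \<Rightarrow> nat \<Rightarrow> 'x \<Rightarrow> bool" where
  zero: "monomial i j 0"
| q: "monomial 0 0 (q r A)"
| s: "\<lbrakk>\<alpha> \<in> L; B \<in> \<I> \<alpha>; monomial i j y\<rbrakk> \<Longrightarrow> monomial (Suc i) j (s \<alpha> B * y)"
| t: "\<lbrakk>\<beta> \<in> L; B \<in> \<I> \<beta>; monomial i j y\<rbrakk> \<Longrightarrow> monomial i (Suc j) (y * t \<beta> B)"

lemma monomials_C: "monomial i j y \<Longrightarrow> y \<in> C"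
  by (induction rule: monomial.induct) (auto simp: C_zero closed)

lemma monomials_left:
  assumes "monomial i j y" and "0 < i"
  shows "y = 0 \<or> (\<exists>\<alpha> B z. \<alpha> \<in> L \<and> B \<in> \<I> \<alpha> \<and> monomial (i - 1) j z \<and> y = s \<alpha> B * z)"
  using assms
proof (induction rule: monomial.induct)
  case (t \<beta> B i j y)
  from t.IH[OF t.prems] show ?case
  proof (elim disjE exE conjE)
    fix \<alpha> B' z
    assume "\<alpha> \<in> L" "B' \<in> \<I> \<alpha>" "monomial (i - 1) j z" "y = s \<alpha> B' * z"
    then have "y * t \<beta> B = s \<alpha> B' * (z * t \<beta> B)" "monomial (i - 1) (Suc j) (z * t \<beta> B)"
      using t.hyps by (auto simp: mult.assoc intro: monomial.t)
    then show ?thesis using \<open>\<alpha> \<in> L\<close> \<open>B' \<in> \<I> \<alpha>\<close> by blast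
  qed auto
qed auto

lemma monomials_right:
  assumes "monomial i j y" and "0 < j"
  shows "y = 0 \<or> (\<exists>\<beta> B z. \<beta> \<in> L \<and> B \<in> \<I> \<beta> \<and> monomial i (j - 1) z \<and> y = z * t \<beta> B)"
  using assms
proof (induction rule: monomial.induct)
  case (s \<alpha> B i j y)
  from s.IH[OF s.prems] show ?case
  proof (elim disjE exE conjE)
    fix \<beta> B' z
    assume "\<beta> \<in> L" "B' \<in> \<I> \<beta>" "monomial i (j - 1) z" "y = z * t \<beta> B'"
    then have "s \<alpha> B * y = (s \<alpha> B * z) * t \<beta> B'" "monomial (Suc i) (j - 1) (s \<alpha> B * z)"
      using s.hyps by (auto simp: mult.assoc intro: monomial.s)
    then show ?thesis using \<open>\<beta> \<in> L\<close> \<open>B' \<in> \<I> \<beta>\<close> by blast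
  qed auto
qed auto

lemma monomials_0_0: "monomial 0 0 y \<Longrightarrow> \<exists>r A. y = q r A"
  by (cases rule: monomial.cases) (auto intro: q_zero[symmetric])

lemma q_monomials:
  "monomial i j y \<Longrightarrow> \<exists>y'. monomial i j y' \<and> q 1 A * y \<approx> y'"
proof (induction arbitrary: A rule: monomial.induct)
  case (zero i j)
  then show ?case using cong_refl monomial.zero by force
next
  case (q r A')
  then show ?case using q_inf' monomial.q by blast
next
  case (s \<alpha> B i j y)
  then obtain y' where y': "monomial i j y'" "q 1 (\<theta> \<alpha> A) * y \<approx> y'" by blast
  have "q 1 A * (s \<alpha> B * y) \<approx> s \<alpha> B * (q 1 (\<theta> \<alpha> A) * y)"
    using cong_right[OF q_s'[of \<alpha> B 1 A] monomials_C] s by (simp add: mult.assoc)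
  also have "\<dots> \<approx> s \<alpha> B * y'"
    using y' s by (simp add: cong_left closed)
  finally show ?case using y' s monomial.s by blast
next
  case (t \<beta> B i j y)
  then obtain y' where y': "monomial i j y'" "q 1 A * y \<approx> y'" by blast
  then have "q 1 A * (y * t \<beta> B) \<approx> y' * t \<beta> B"
    using t cong_right[OF y'(2) t_C] by (simp add: mult.assoc)
  then show ?case using y' t monomial.t by blast
qed

lemma monomials_q:
  "monomial i j y \<Longrightarrow> \<exists>y'. monomial i j y' \<and> y * q 1 A \<approx> y'"
proof (induction arbitrary: A rule: monomial.induct)
  case (zero i j)
  then show ?case using cong_refl monomial.zero by force
next
  case (q r A')
  then show ?case using q_inf' monomial.q by blast
next
  case (s \<alpha> B i j y)
  then obtain y' where y': "monomial i j y'" "y * q 1 A \<approx> y'" by blast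
  then have "(s \<alpha> B * y) * q 1 A \<approx> s \<alpha> B * y'"
    using s cong_left[OF y'(2) s_C] by (simp add: mult.assoc)
  then show ?case using y' s monomial.s by blast
next
  case (t \<beta> B i j y)
  then obtain y' where y': "monomial i j y'" "y * q 1 (\<theta> \<beta> A) \<approx> y'" by blast
  have "y * t \<beta> B * q 1 A \<approx> y * q 1 (\<theta> \<beta> A) * t \<beta> B"
    using cong_left[OF t_q'[of \<beta> B 1 A] monomials_C] t by (simp add: mult.assoc)
  also have "\<dots> \<approx> y' * t \<beta> B"
    using y' t by (simp add: cong_right closed)
  finally show ?case using y' t monomial.t by blast
qed

lemma t_monomials:
  assumes "monomial i j y" "0 < i" "\<alpha> \<in> L" "B \<in> \<I> \<alpha>"
  shows "\<exists>y'. monomial (i - 1) j y' \<and> t \<alpha> B * y \<approx> y'"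
  using monomials_left[OF assms(1,2)]
proof (elim disjE exE conjE)
  fix \<alpha>' B' z
  assume z: "\<alpha>' \<in> L" "B' \<in> \<I> \<alpha>'" "monomial (i - 1) j z" "y = s \<alpha>' B' * z"
  show ?thesis
  proof (cases "\<alpha> = \<alpha>'")
    case True
    then have "t \<alpha> B * y \<approx> q 1 (inf B B') * z"
      using z assms cong_right[OF t_s'[of \<alpha> B B'] monomials_C[OF z(3)]] by (simp add: mult.assoc)
    then show ?thesis using q_monomials[OF z(3)] cong_trans by meson
  next
    case False
    then have "t \<alpha> B * y \<in> J"
      using z assms J_right[OF monomials_C[OF z(3)] t_s_diff[of \<alpha> B \<alpha>' B']] by (simp add: mult.assoc)
    then show ?thesis using monomial.zero cong_zero by blast
  qed
qed (use cong_refl monomial.zero in force)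

lemma monomials_s:
  assumes "monomial i j y" "0 < j" "\<alpha> \<in> L" "B \<in> \<I> \<alpha>"
  shows "\<exists>y'. monomial i (j - 1) y' \<and> y * s \<alpha> B \<approx> y'"
  using monomials_right[OF assms(1,2)]
proof (elim disjE exE conjE)
  fix \<alpha>' B' z
  assume z: "\<alpha>' \<in> L" "B' \<in> \<I> \<alpha>'" "monomial i (j - 1) z" "y = z * t \<alpha>' B'"
  show ?thesis
  proof (cases "\<alpha>' = \<alpha>")
    case True
    then have "y * s \<alpha> B \<approx> z * q 1 (inf B' B)"
      using z assms cong_left[OF t_s'[of \<alpha> B' B] monomials_C[OF z(3)]] by (simp add: mult.assoc)
    then show ?thesis using monomials_q[OF z(3)] cong_trans by meson
  next
    case False
    then have "y * s \<alpha> B \<in> J"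
      using z assms J_left[OF monomials_C[OF z(3)] t_s_diff[of \<alpha>' B' \<alpha> B]] by (simp add: mult.assoc)
    then show ?thesis using monomial.zero cong_zero by blast
  qed
qed (use cong_refl monomial.zero in force)

lemma t_monomials_0:
  "monomial i j y \<Longrightarrow> i = 0 \<Longrightarrow> \<alpha> \<in> L \<Longrightarrow> B \<in> \<I> \<alpha> \<Longrightarrow>
    \<exists>y'. monomial 0 (Suc j) y' \<and> t \<alpha> B * y \<approx> y'"
proof (induction rule: monomial.induct)
  case (zero i j)
  then show ?case using cong_refl monomial.zero by force
next
  case (q r A)
  then show ?case using t_q'[of \<alpha> B r A] monomial.q[of r "\<theta> \<alpha> A"] monomial.t by blast
next
  case (t \<beta> D i j y)
  then obtain y' where y': "monomial 0 (Suc j) y'" "t \<alpha> B * y \<approx> y'" by blast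
  then have "t \<alpha> B * (y * t \<beta> D) \<approx> y' * t \<beta> D"
    using t cong_right[OF y'(2) t_C] by (simp add: mult.assoc)
  then show ?case using y' t monomial.t by blast
qed auto

text \<open>The monomials of degree \<open>n\<close>.\<close>

definition homogeneous_monomials :: "int \<Rightarrow> 'x set" where
  "homogeneous_monomials n = {y. \<exists>i j. monomial i j y \<and> int i - int j = n}"

lemma homogeneous_monomials_q: "y \<in> homogeneous_monomials n \<Longrightarrow> \<exists>y'\<in>homogeneous_monomials n. q 1 A * y \<approx> y'"
  unfolding homogeneous_monomials_def using q_monomials by blast

lemma homogeneous_monomials_s:
  "y \<in> homogeneous_monomials n \<Longrightarrow> \<alpha> \<in> L \<Longrightarrow> B \<in> \<I> \<alpha> \<Longrightarrow> s \<alpha> B * y \<in> homogeneous_monomials (n + 1)"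
  unfolding homogeneous_monomials_def using monomial.s by fastforce

lemma homogeneous_monomials_t:
  assumes "y \<in> homogeneous_monomials n" "\<alpha> \<in> L" "B \<in> \<I> \<alpha>"
  shows "\<exists>y'\<in>homogeneous_monomials (n - 1). t \<alpha> B * y \<approx> y'"
proof -
  obtain i j where ij: "monomial i j y" "int i - int j = n"
    using assms by (auto simp: homogeneous_monomials_def)
  show ?thesis
  proof (cases i)
    case 0
    then show ?thesis
      using t_monomials_0[OF ij(1) _ assms(2,3)] ij(2) unfolding homogeneous_monomials_def by fastforce
  next
    case (Suc k)
    then show ?thesis
      using t_monomials[OF ij(1) _ assms(2,3)] ij(2) unfolding homogeneous_monomials_def by fastforce
  qed
qed

subsection \<open>Detecting zero by multiplication with generators\<close>

text \<open>
  The induction removes the first summand \<open>s \<alpha> B * y\<close>: with \<open>e = s \<alpha> B * t \<alpha> B\<close>, passing from \<open>x\<close> to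
  \<open>x - e * x\<close> kills it, keeps the shape of the other summands, and does not change \<open>x\<close> modulo \<open>J\<close>.
\<close>

lemma left_detect:
  assumes "\<And>\<alpha> B y. (\<alpha>, B, y) \<in> set xs \<Longrightarrow> \<alpha> \<in> L \<and> B \<in> \<I> \<alpha> \<and> y \<in> C"
    and "x \<approx> (\<Sum>(\<alpha>, B, y)\<leftarrow>xs. s \<alpha> B * y)"
    and "\<And>\<alpha> B. \<alpha> \<in> L \<Longrightarrow> B \<in> \<I> \<alpha> \<Longrightarrow> t \<alpha> B * x \<in> J"
  shows "x \<in> J"
  using assms(1,2)
proof (induction "length xs" arbitrary: xs)
  case 0
  then show ?case using cong_zero by simp
next
  case (Suc n)
  then obtain \<alpha> B y ys where xs: "xs = (\<alpha>, B, y) # ys" and n: "n = length ys"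
    by (metis Suc_length_conv prod_cases3)
  have ab: "\<alpha> \<in> L" "B \<in> \<I> \<alpha>" "y \<in> C"
    using Suc.prems(1) xs by auto
  define e where "e = s \<alpha> B * t \<alpha> B"
  have e: "e \<in> C" using ab by (simp add: e_def closed)
  define h where "h = (\<lambda>(\<alpha>', B'::'b, y'). (\<alpha>', B', if \<alpha>' = \<alpha> then y' - q 1 B * y' else y'))"
  have step: "s \<alpha>' B' * y' - e * (s \<alpha>' B' * y') \<approx> s \<alpha>' B' * (if \<alpha>' = \<alpha> then y' - q 1 B * y' else y')"
    if "(\<alpha>', B', y') \<in> set xs" for \<alpha>' B' y'
  proof -
    have ab': "\<alpha>' \<in> L" "B' \<in> \<I> \<alpha>'" "y' \<in> C" using Suc.prems(1) that by auto
    show ?thesis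
    proof (cases "\<alpha>' = \<alpha>")
      case True
      have "t \<alpha> B * s \<alpha> B' * y' \<approx> q 1 (inf B B') * y'"
        using ab ab' True by (simp add: cong_right t_s')
      then have "e * (s \<alpha> B' * y') \<approx> s \<alpha> B * q 1 (inf B B') * y'"
        using cong_left[of _ _ "s \<alpha> B"] ab by (simp add: e_def mult.assoc closed)
      also have "\<dots> \<approx> s \<alpha> (inf B (inf B B')) * y'"
        using ab ab' by (intro cong_right s_q')
      also have "\<dots> = s \<alpha> (inf B' B) * y'"
        by (metis inf.commute inf.left_idem)
      also have "\<dots> \<approx> s \<alpha> B' * q 1 B * y'"
        using ab ab' True by (intro cong_right[OF cong_sym[OF s_q']]) auto
      finally show ?thesis
        using cong_diff[OF cong_refl[of "s \<alpha> B' * y'"]] True by (simp add: algebra_simps)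
    next
      case False
      have "e * (s \<alpha>' B' * y') \<in> J"
        unfolding e_def using J_left[OF s_C J_right[OF _ t_s_diff]] ab ab' False by (simp add: mult.assoc)
      then show ?thesis
        using False cong_diff[OF cong_refl[of "s \<alpha>' B' * y'"], of _ 0] cong_zero by simp
    qed
  qed
  have "x - e * x \<approx> (\<Sum>(\<alpha>', B', y')\<leftarrow>xs. s \<alpha>' B' * y') - e * (\<Sum>(\<alpha>', B', y')\<leftarrow>xs. s \<alpha>' B' * y')"
    by (intro cong_diff cong_left Suc.prems e)
  also have "\<dots> = (\<Sum>(\<alpha>', B', y')\<leftarrow>xs. s \<alpha>' B' * y' - e * (s \<alpha>' B' * y'))"
    by (simp add: sum_list_const_mult sum_list_subtractf case_prod_unfold flip: sum_list_const_mult)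
  also have "\<dots> \<approx> (\<Sum>(\<alpha>', B', y')\<leftarrow>xs. s \<alpha>' B' * (if \<alpha>' = \<alpha> then y' - q 1 B * y' else y'))"
  proof (rule cong_sum_list, clarify)
    fix \<alpha>' B' y'
    assume "(\<alpha>', B', y') \<in> set xs"
    then show "s \<alpha>' B' * y' - e * (s \<alpha>' B' * y') \<approx> s \<alpha>' B' * (if \<alpha>' = \<alpha> then y' - q 1 B * y' else y')"
      by (rule step)
  qed
  also have "\<dots> = s \<alpha> B * (y - q 1 B * y) + (\<Sum>(\<alpha>', B', y')\<leftarrow>map h ys. s \<alpha>' B' * y')"
    by (auto simp: xs h_def comp_def case_prod_unfold intro!: arg_cong[of _ _ sum_list])
  also have "\<dots> \<approx> 0 + (\<Sum>(\<alpha>', B', y')\<leftarrow>map h ys. s \<alpha>' B' * y')"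
  proof (intro cong_add cong_refl)
    have "s \<alpha> B * y - s \<alpha> B * q 1 B * y \<approx> s \<alpha> B * y - s \<alpha> B * y"
      by (intro cong_diff cong_refl cong_right s_q_same ab)
    then show "s \<alpha> B * (y - q 1 B * y) \<approx> 0" by (simp add: algebra_simps)
  qed
  finally have "x - e * x \<approx> (\<Sum>(\<alpha>', B', y')\<leftarrow>map h ys. s \<alpha>' B' * y')" by simp
  moreover have "x \<approx> x - e * x"
    using J_left[OF s_C assms(3)] ab by (simp add: cong_def e_def mult.assoc)
  ultimately have "x \<approx> (\<Sum>(\<alpha>', B', y')\<leftarrow>map h ys. s \<alpha>' B' * y')"
    using cong_trans by blast
  moreover have "\<alpha>' \<in> L \<and> B' \<in> \<I> \<alpha>' \<and> y' \<in> C" if "(\<alpha>', B', y') \<in> set (map h ys)" for \<alpha>' B' y'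
    using that Suc.prems(1) by (fastforce simp: h_def xs closed split: if_splits)
  ultimately show ?case using Suc.hyps(1)[of "map h ys"] n by simp
qed

lemma right_detect:
  assumes "\<And>\<beta> B y. (\<beta>, B, y) \<in> set xs \<Longrightarrow> \<beta> \<in> L \<and> B \<in> \<I> \<beta> \<and> y \<in> C"
    and "x \<approx> (\<Sum>(\<beta>, B, y)\<leftarrow>xs. y * t \<beta> B)"
    and "\<And>\<beta> B. \<beta> \<in> L \<Longrightarrow> B \<in> \<I> \<beta> \<Longrightarrow> x * s \<beta> B \<in> J"
  shows "x \<in> J"
  using assms(1,2)
proof (induction "length xs" arbitrary: xs)
  case 0
  then show ?case using cong_zero by simp
next
  case (Suc n)
  then obtain \<beta> B y ys where xs: "xs = (\<beta>, B, y) # ys" and n: "n = length ys"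
    by (metis Suc_length_conv prod_cases3)
  have ab: "\<beta> \<in> L" "B \<in> \<I> \<beta>" "y \<in> C"
    using Suc.prems(1) xs by auto
  define e where "e = s \<beta> B * t \<beta> B"
  have e: "e \<in> C" using ab by (simp add: e_def closed)
  define h where "h = (\<lambda>(\<beta>', B'::'b, y'). (\<beta>', B', if \<beta>' = \<beta> then y' - y' * q 1 B else y'))"
  have step: "y' * t \<beta>' B' - (y' * t \<beta>' B') * e \<approx> (if \<beta>' = \<beta> then y' - y' * q 1 B else y') * t \<beta>' B'"
    if "(\<beta>', B', y') \<in> set xs" for \<beta>' B' y'
  proof -
    have ab': "\<beta>' \<in> L" "B' \<in> \<I> \<beta>'" "y' \<in> C" using Suc.prems(1) that by auto
    show ?thesis
    proof (cases "\<beta>' = \<beta>")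
      case True
      have "y' * (t \<beta> B' * s \<beta> B) \<approx> y' * q 1 (inf B' B)"
        using ab ab' True by (simp add: cong_left t_s')
      then have "y' * (t \<beta> B' * s \<beta> B) * t \<beta> B \<approx> y' * q 1 (inf B' B) * t \<beta> B"
        using ab by (intro cong_right t_C)
      then have "(y' * t \<beta> B') * e \<approx> y' * (q 1 (inf B' B) * t \<beta> B)"
        by (simp add: e_def mult.assoc)
      also have "\<dots> \<approx> y' * t \<beta> (inf B (inf B' B))"
        using ab ab' by (intro cong_left q_t')
      also have "\<dots> = y' * t \<beta> (inf B' B)"
        by (metis inf.commute inf.left_idem)
      also have "\<dots> \<approx> y' * (q 1 B * t \<beta> B')"
        using ab ab' True by (intro cong_left[OF cong_sym[OF q_t']]) auto
      finally show ?thesis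
        using cong_diff[OF cong_refl[of "y' * t \<beta> B'"]] True by (simp add: algebra_simps)
    next
      case False
      have "(y' * t \<beta>' B') * e \<in> J"
        unfolding e_def using J_right[OF t_C J_left[OF _ t_s_diff]] ab ab' False by (simp add: mult.assoc)
      then show ?thesis
        using False cong_diff[OF cong_refl[of "y' * t \<beta>' B'"], of _ 0] cong_zero by simp
    qed
  qed
  have "x - x * e \<approx> (\<Sum>(\<beta>', B', y')\<leftarrow>xs. y' * t \<beta>' B') - (\<Sum>(\<beta>', B', y')\<leftarrow>xs. y' * t \<beta>' B') * e"
    by (intro cong_diff cong_right Suc.prems e)
  also have "\<dots> = (\<Sum>(\<beta>', B', y')\<leftarrow>xs. y' * t \<beta>' B' - (y' * t \<beta>' B') * e)"
    by (simp add: sum_list_mult_const sum_list_subtractf case_prod_unfold flip: sum_list_mult_const)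
  also have "\<dots> \<approx> (\<Sum>(\<beta>', B', y')\<leftarrow>xs. (if \<beta>' = \<beta> then y' - y' * q 1 B else y') * t \<beta>' B')"
  proof (rule cong_sum_list, clarify)
    fix \<beta>' B' y'
    assume "(\<beta>', B', y') \<in> set xs"
    then show "y' * t \<beta>' B' - (y' * t \<beta>' B') * e \<approx> (if \<beta>' = \<beta> then y' - y' * q 1 B else y') * t \<beta>' B'"
      by (rule step)
  qed
  also have "\<dots> = (y - y * q 1 B) * t \<beta> B + (\<Sum>(\<beta>', B', y')\<leftarrow>map h ys. y' * t \<beta>' B')"
    by (auto simp: xs h_def comp_def case_prod_unfold intro!: arg_cong[of _ _ sum_list])
  also have "\<dots> \<approx> 0 + (\<Sum>(\<beta>', B', y')\<leftarrow>map h ys. y' * t \<beta>' B')"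
  proof (intro cong_add cong_refl)
    have "y * t \<beta> B - y * (q 1 B * t \<beta> B) \<approx> y * t \<beta> B - y * t \<beta> B"
      by (intro cong_diff cong_refl cong_left q_t_same ab)
    then show "(y - y * q 1 B) * t \<beta> B \<approx> 0" by (simp add: algebra_simps)
  qed
  finally have "x - x * e \<approx> (\<Sum>(\<beta>', B', y')\<leftarrow>map h ys. y' * t \<beta>' B')" by simp
  moreover have "x \<approx> x - x * e"
    using J_right[OF t_C assms(3)] ab by (simp add: cong_def e_def mult.assoc)
  ultimately have "x \<approx> (\<Sum>(\<beta>', B', y')\<leftarrow>map h ys. y' * t \<beta>' B')"
    using cong_trans by blast
  moreover have "\<beta>' \<in> L \<and> B' \<in> \<I> \<beta>' \<and> y' \<in> C" if "(\<beta>', B', y') \<in> set (map h ys)" for \<beta>' B' y'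
    using that Suc.prems(1) by (fastforce simp: h_def xs closed split: if_splits)
  ultimately show ?case using Suc.hyps(1)[of "map h ys"] n by simp
qed

lemma two_sided_detect:
  assumes zs: "\<And>\<alpha> B y \<beta> B'. (\<alpha>, B, y, \<beta>, B') \<in> set zs \<Longrightarrow>
      \<alpha> \<in> L \<and> B \<in> \<I> \<alpha> \<and> y \<in> C \<and> \<beta> \<in> L \<and> B' \<in> \<I> \<beta>"
    and x: "x \<approx> (\<Sum>(\<alpha>, B, y, \<beta>, B')\<leftarrow>zs. s \<alpha> B * y * t \<beta> B')"
    and J: "\<And>\<alpha> B \<beta> B'. \<alpha> \<in> L \<Longrightarrow> B \<in> \<I> \<alpha> \<Longrightarrow> \<beta> \<in> L \<Longrightarrow> B' \<in> \<I> \<beta> \<Longrightarrow> t \<alpha> B * x * s \<beta> B' \<in> J"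
  shows "x \<in> J"
proof (rule left_detect)
  show "x \<approx> (\<Sum>(\<alpha>, B, y)\<leftarrow>map (\<lambda>(\<alpha>, B, y, \<beta>, B'). (\<alpha>, B, y * t \<beta> B')) zs. s \<alpha> B * y)"
    using x by (simp add: comp_def case_prod_unfold mult.assoc)
  show "\<alpha> \<in> L \<and> B \<in> \<I> \<alpha> \<and> y \<in> C"
    if "(\<alpha>, B, y) \<in> set (map (\<lambda>(\<alpha>, B, y, \<beta>, B'). (\<alpha>, B, y * t \<beta> B')) zs)" for \<alpha> B y
    using that zs by (fastforce simp: closed)
  fix \<alpha> B
  assume ab: "\<alpha> \<in> L" "B \<in> \<I> \<alpha>"
  show "t \<alpha> B * x \<in> J"
  proof (rule right_detect)
    have "t \<alpha> B * x \<approx> t \<alpha> B * (\<Sum>(\<alpha>, B, y, \<beta>, B')\<leftarrow>zs. s \<alpha> B * y * t \<beta> B')"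
      using x ab by (intro cong_left closed)
    then show "t \<alpha> B * x \<approx> (\<Sum>(\<beta>, B', y)\<leftarrow>map (\<lambda>(\<alpha>', B', y, \<beta>, D). (\<beta>, D, t \<alpha> B * s \<alpha>' B' * y)) zs. y * t \<beta> B')"
      by (simp add: comp_def case_prod_unfold mult.assoc flip: sum_list_const_mult)
    show "\<beta> \<in> L \<and> B' \<in> \<I> \<beta> \<and> y \<in> C"
      if "(\<beta>, B', y) \<in> set (map (\<lambda>(\<alpha>', B', y, \<beta>, D). (\<beta>, D, t \<alpha> B * s \<alpha>' B' * y)) zs)" for \<beta> B' y
      using that zs ab by (fastforce simp: closed)
    show "t \<alpha> B * x * s \<beta> B' \<in> J" if "\<beta> \<in> L" "B' \<in> \<I> \<beta>" for \<beta> B'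
      using J ab that by blast
  qed
qed

end

section \<open>Sums of monomials of degree zero\<close>

context gbds_congruence
begin

lemma q_refine: "(\<Sum>(r, A)\<leftarrow>refine r A ys. q r A) \<approx> q r A + (\<Sum>(r, A)\<leftarrow>ys. q r A)"
proof (induction r A ys rule: refine.induct)
  case (1 r A)
  then show ?case by (simp add: cong_refl)
next
  case (2 r A r' D ys)
  have "(\<Sum>(r, A)\<leftarrow>refine r A ((r', D) # ys). q r A) =
      q r (inf A D) + (q r' (D - A) + q r' (inf D A)) + (\<Sum>(r, A)\<leftarrow>refine r (A - D) ys. q r A)"
    by (simp add: q_add inf.commute algebra_simps)
  also have "\<dots> \<approx> q r (inf A D) + q r' D + (q r (A - D) + (\<Sum>(r, A)\<leftarrow>ys. q r A))"
    by (intro cong_add cong_refl q_diff 2)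
  also have "\<dots> = (q r (A - D) + q r (inf A D)) + (\<Sum>(r, A)\<leftarrow>(r', D) # ys. q r A)"
    by (simp add: algebra_simps)
  also have "\<dots> \<approx> q r A + (\<Sum>(r, A)\<leftarrow>(r', D) # ys. q r A)"
    by (intro cong_add cong_refl q_diff)
  finally show ?case .
qed

lemma disjoint_form: "\<exists>ys. disjoint_list ys \<and> (\<Sum>(r, A)\<leftarrow>xs. q r A) \<approx> (\<Sum>(r, A)\<leftarrow>ys. q r A)"
proof (induction xs)
  case Nil
  show ?case by (rule exI[of _ "[]"]) (simp add: cong_refl)
next
  case (Cons x xs)
  then obtain ys where ys: "disjoint_list ys" "(\<Sum>(r, A)\<leftarrow>xs. q r A) \<approx> (\<Sum>(r, A)\<leftarrow>ys. q r A)"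
    by blast
  obtain r A where x: "x = (r, A)" by (cases x)
  have "(\<Sum>(r, A)\<leftarrow>x # xs. q r A) = q r A + (\<Sum>(r, A)\<leftarrow>xs. q r A)"
    by (simp add: x)
  also have "\<dots> \<approx> q r A + (\<Sum>(r, A)\<leftarrow>ys. q r A)"
    by (intro cong_add cong_refl ys)
  also have "\<dots> \<approx> (\<Sum>(r, A)\<leftarrow>refine r A ys. q r A)"
    by (rule cong_sym[OF q_refine])
  finally show ?case using disjoint_list_refine[OF ys(1)] by blast
qed

lemma q_disjoint_sum:
  assumes "\<And>x. x \<in> set ys \<Longrightarrow> inf B (snd x) = bot"
  shows "q 1 B * (\<Sum>(r, A)\<leftarrow>ys. q r A) \<in> J"
  unfolding sum_list_const_mult[symmetric]
  by (rule J_sum_list) (use assms q_disjoint in \<open>auto simp: case_prod_unfold\<close>)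

text \<open>Multiplication by \<open>q 1 B\<close> with \<open>B \<le> A\<close> isolates the coefficient of \<open>A\<close>.\<close>

lemma q_pick:
  assumes "disjoint_list ys" "(r, A) \<in> set ys" "B \<le> A"
  shows "q 1 B * (\<Sum>(r, A)\<leftarrow>ys. q r A) \<approx> q r B"
  using assms
proof (induction ys)
  case (Cons x ys)
  obtain r' A' where x: "x = (r', A')" by (cases x)
  show ?case
  proof (cases "(r, A) = x")
    case True
    have "q 1 B * q r A \<approx> q r B"
      using q_inf'[of 1 B r A] Cons.prems(3) by (simp add: inf.absorb1)
    moreover have "inf B (snd y) = bot" if "y \<in> set ys" for y
      using that Cons.prems True inf_bot_mono[of A "snd y" B] by auto
    then have "q 1 B * (\<Sum>(r, A)\<leftarrow>ys. q r A) \<approx> 0"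
      using q_disjoint_sum cong_zero by blast
    ultimately show ?thesis
      using cong_add[of "q 1 B * q r A" "q r B" _ 0] True by (auto simp: distrib_left)
  next
    case False
    then have "q 1 B * (\<Sum>(r, A)\<leftarrow>ys. q r A) \<approx> q r B"
      using Cons by auto
    moreover have "inf A A' = bot"
      using Cons.prems False x by (auto simp: inf.commute)
    then have "q 1 B * q r' A' \<approx> 0"
      using q_disjoint[of B A'] inf_bot_mono[of A A' B] Cons.prems(3) cong_zero by blast
    ultimately show ?thesis
      using cong_add[of "q 1 B * q r' A'" 0 _ "q r B"] x by (simp add: distrib_left)
  qed
qed simp

lemma cong_sum_list_ex:
  assumes "\<And>m. m \<in> set ms \<Longrightarrow> \<exists>m'. P m' \<and> h m \<approx> m'"
  shows "\<exists>ms'. (\<forall>m\<in>set ms'. P m) \<and> sum_list (map h ms) \<approx> sum_list ms'"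
  using assms
proof (induction ms)
  case Nil
  show ?case by (rule exI[of _ "[]"]) (simp add: cong_refl)
next
  case (Cons m ms)
  then obtain m' ms' where "P m'" "h m \<approx> m'" "\<forall>m\<in>set ms'. P m" "sum_list (map h ms) \<approx> sum_list ms'"
    by (metis list.set_intros)
  then show ?case
    by (intro exI[of _ "m' # ms'"]) (simp add: cong_add)
qed

lemma t_monomials_s:
  assumes "monomial i i m" "i \<le> Suc N" "\<alpha> \<in> L" "B \<in> \<I> \<alpha>" "\<beta> \<in> L" "B' \<in> \<I> \<beta>"
  shows "\<exists>m'. (\<exists>i\<le>N. monomial i i m') \<and> t \<alpha> B * m * s \<beta> B' \<approx> m'"
proof (cases i)
  case 0
  then obtain r A where m: "m = q r A" using assms(1) monomials_0_0[of m] by blast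
  have *: "t \<alpha> B * m * s \<beta> B' \<approx> q r (\<theta> \<alpha> A) * (t \<alpha> B * s \<beta> B')"
    using cong_right[OF t_q' s_C] assms m by (simp add: mult.assoc)
  show ?thesis
  proof (cases "\<alpha> = \<beta>")
    case True
    have "q r (\<theta> \<alpha> A) * (t \<alpha> B * s \<beta> B') \<approx> q r (\<theta> \<alpha> A) * q 1 (inf B B')"
      using True assms by (simp add: cong_left t_s' closed)
    also have "\<dots> \<approx> q (r * 1) (inf (\<theta> \<alpha> A) (inf B B'))" by (rule q_inf')
    finally show ?thesis using * cong_trans monomial.q by blast
  next
    case False
    have "q r (\<theta> \<alpha> A) * (t \<alpha> B * s \<beta> B') \<approx> 0"
      using False assms by (simp add: cong_zero J_left t_s_diff closed)
    then show ?thesis using * cong_trans monomial.zero by blast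
  qed
next
  case (Suc k)
  then obtain y where y: "monomial k (Suc k) y" "t \<alpha> B * m \<approx> y"
    using t_monomials[OF assms(1) _ assms(3,4)] by auto
  then obtain z where z: "monomial k k z" "y * s \<beta> B' \<approx> z"
    using monomials_s[OF y(1) _ assms(5,6)] by auto
  have "t \<alpha> B * m * s \<beta> B' \<approx> z"
    using cong_right[OF y(2) s_C[OF assms(5,6)]] z(2) cong_trans by blast
  then show ?thesis using z Suc assms(2) by (intro exI[of _ z]) auto
qed

text \<open>The expansion of \<open>q r A\<close> by the relation for regular elements, as a list of summands.\<close>

lemma q_regular_scaled:
  assumes "A \<in> regular_elements L \<theta>" "finite (Delta L \<theta> A)"
  shows "\<exists>zs. (\<forall>(\<alpha>, B, y, \<beta>, B')\<in>set zs. \<alpha> \<in> L \<and> B \<in> \<I> \<alpha> \<and> y \<in> C \<and> \<beta> \<in> L \<and> B' \<in> \<I> \<beta>) \<and>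
    q r A \<approx> (\<Sum>(\<alpha>, B, y, \<beta>, B')\<leftarrow>zs. s \<alpha> B * y * t \<beta> B')"
proof -
  obtain as where as: "set as = Delta L \<theta> A" "distinct as"
    using finite_distinct_list[OF assms(2)] by blast
  have asL: "\<alpha> \<in> L" if "\<alpha> \<in> set as" for \<alpha>
    using that as by (auto simp: Delta_def)
  let ?zs = "map (\<lambda>\<alpha>. (\<alpha>, \<theta> \<alpha> A, q r (\<theta> \<alpha> A), \<alpha>, \<theta> \<alpha> A)) as"
  have "q r A \<approx> q r A * q 1 A"
    using q_inf'[of r A 1 A] cong_sym by simp
  also have "\<dots> \<approx> q r A * (\<Sum>\<alpha>\<in>Delta L \<theta> A. s \<alpha> (\<theta> \<alpha> A) * t \<alpha> (\<theta> \<alpha> A))"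
    using q_regular[OF assms(1)] by (intro cong_left closed) (simp add: cong_def)
  also have "\<dots> = (\<Sum>\<alpha>\<leftarrow>as. q r A * s \<alpha> (\<theta> \<alpha> A) * t \<alpha> (\<theta> \<alpha> A))"
    by (simp add: mult.assoc sum_list_const_mult sum_list_distinct_conv_sum_set as)
  also have "\<dots> \<approx> (\<Sum>\<alpha>\<leftarrow>as. s \<alpha> (\<theta> \<alpha> A) * q r (\<theta> \<alpha> A) * t \<alpha> (\<theta> \<alpha> A))"
    by (intro cong_sum_list cong_right q_s' t_C asL theta_ideal)
  also have "\<dots> = (\<Sum>(\<alpha>, B, y, \<beta>, B')\<leftarrow>?zs. s \<alpha> B * y * t \<beta> B')"
    by (simp add: comp_def)
  finally show ?thesis
    using asL theta_ideal closed by (intro exI[of _ ?zs]) auto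
qed

lemma regular_finite: "A \<in> regular_elements L \<theta> \<Longrightarrow> finite (Delta L \<theta> A)"
proof (cases "A = bot")
  case True
  have "Delta L \<theta> bot = {}" by (auto simp: Delta_def theta_bot)
  then show ?thesis using True by simp
qed (auto simp: regular_elements_def)

lemma regular_sum:
  assumes "\<And>r A. (r, A) \<in> set ys \<Longrightarrow> r = 0 \<or> A \<in> regular_elements L \<theta>"
  shows "\<exists>zs. (\<forall>(\<alpha>, B, y, \<beta>, B')\<in>set zs. \<alpha> \<in> L \<and> B \<in> \<I> \<alpha> \<and> y \<in> C \<and> \<beta> \<in> L \<and> B' \<in> \<I> \<beta>) \<and>
    (\<Sum>(r, A)\<leftarrow>ys. q r A) \<approx> (\<Sum>(\<alpha>, B, y, \<beta>, B')\<leftarrow>zs. s \<alpha> B * y * t \<beta> B')"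
  using assms
proof (induction ys)
  case Nil
  show ?case by (rule exI[of _ "[]"]) (simp add: cong_refl)
next
  case (Cons x ys)
  obtain r A where x: "x = (r, A)" by (cases x)
  obtain zs where zs: "\<forall>(\<alpha>, B, y, \<beta>, B')\<in>set zs. \<alpha> \<in> L \<and> B \<in> \<I> \<alpha> \<and> y \<in> C \<and> \<beta> \<in> L \<and> B' \<in> \<I> \<beta>"
    "(\<Sum>(r, A)\<leftarrow>ys. q r A) \<approx> (\<Sum>(\<alpha>, B, y, \<beta>, B')\<leftarrow>zs. s \<alpha> B * y * t \<beta> B')"
    using Cons by (metis (no_types, lifting) list.set_intros(2))
  obtain zs' where zs': "\<forall>(\<alpha>, B, y, \<beta>, B')\<in>set zs'. \<alpha> \<in> L \<and> B \<in> \<I> \<alpha> \<and> y \<in> C \<and> \<beta> \<in> L \<and> B' \<in> \<I> \<beta>"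
    "q r A \<approx> (\<Sum>(\<alpha>, B, y, \<beta>, B')\<leftarrow>zs'. s \<alpha> B * y * t \<beta> B')"
  proof (cases "r = 0")
    case True
    then show ?thesis using that[of "[]"] by (simp add: q_zero cong_refl)
  next
    case False
    then have "A \<in> regular_elements L \<theta>" using Cons.prems x by auto
    then show ?thesis using q_regular_scaled regular_finite that by blast
  qed
  show ?case
    using zs zs' cong_add[OF zs'(2) zs(2)] x by (intro exI[of _ "zs' @ zs"]) auto
qed

text \<open>
  For \<open>N = 0\<close> there are no summands of the second kind; this is the base case of the induction on \<open>N\<close>.
\<close>

lemma split_monomials:
  assumes "\<And>m. m \<in> set ms \<Longrightarrow> \<exists>i\<le>N. monomial i i m"
  shows "\<exists>ys zs. (\<forall>(\<alpha>, B, y, \<beta>, B')\<in>set zs. \<alpha> \<in> L \<and> B \<in> \<I> \<alpha> \<and> y \<in> C \<and> \<beta> \<in> L \<and> B' \<in> \<I> \<beta>) \<and>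
    (N = 0 \<longrightarrow> zs = []) \<and>
    sum_list ms = (\<Sum>(r, A)\<leftarrow>ys. q r A) + (\<Sum>(\<alpha>, B, y, \<beta>, B')\<leftarrow>zs. s \<alpha> B * y * t \<beta> B')"
  using assms
proof (induction ms)
  case Nil
  show ?case by (intro exI[of _ "[]"]) simp
next
  case (Cons m ms)
  then obtain ys zs where yz: "\<forall>(\<alpha>, B, y, \<beta>, B')\<in>set zs. \<alpha> \<in> L \<and> B \<in> \<I> \<alpha> \<and> y \<in> C \<and> \<beta> \<in> L \<and> B' \<in> \<I> \<beta>"
    "N = 0 \<longrightarrow> zs = []"
    "sum_list ms = (\<Sum>(r, A)\<leftarrow>ys. q r A) + (\<Sum>(\<alpha>, B, y, \<beta>, B')\<leftarrow>zs. s \<alpha> B * y * t \<beta> B')"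
    by (metis (no_types, lifting) list.set_intros(2))
  obtain i where i: "i \<le> N" "monomial i i m" using Cons.prems by auto
  consider r A where "m = q r A" | "m = 0" | \<alpha> B y \<beta> B' where
    "\<alpha> \<in> L" "B \<in> \<I> \<alpha>" "y \<in> C" "\<beta> \<in> L" "B' \<in> \<I> \<beta>" "m = s \<alpha> B * y * t \<beta> B'" "N \<noteq> 0"
  proof (cases i)
    case 0
    then show ?thesis using i(2) monomials_0_0[of m] that(1) by blast
  next
    case (Suc k)
    then have "0 < i" by simp
    show ?thesis
      using monomials_left[OF i(2) \<open>0 < i\<close>]
    proof (elim disjE exE conjE)
      fix \<alpha> B z
      assume z: "\<alpha> \<in> L" "B \<in> \<I> \<alpha>" "monomial (i - 1) i z" "m = s \<alpha> B * z"
      show ?thesis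
        using monomials_right[OF z(3) \<open>0 < i\<close>]
      proof (elim disjE exE conjE)
        fix \<beta> B' y
        assume "\<beta> \<in> L" "B' \<in> \<I> \<beta>" "monomial (i - 1) (i - 1) y" "z = y * t \<beta> B'"
        then show ?thesis using z that(3)[of \<alpha> B y \<beta> B'] monomials_C Suc i(1) by (simp add: mult.assoc)
      qed (use that(2) z Suc in auto)
    qed (use that(2) Suc in auto)
  qed
  then show ?case
  proof cases
    case (1 r A)
    then show ?thesis using yz
      by (intro exI[of _ "(r, A) # ys"] exI[of _ zs]) (simp add: add.assoc)
  next
    case 2
    then show ?thesis using yz by auto
  next
    case (3 \<alpha> B y \<beta> B')
    then show ?thesis using yz
      by (intro exI[of _ ys] exI[of _ "(\<alpha>, B, y, \<beta>, B') # zs"]) (simp add: algebra_simps)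
  qed
qed

end

section \<open>Graded uniqueness\<close>

text \<open>An ideal \<open>K\<close> containing \<open>J\<close> but none of the elements \<open>q r A\<close> with \<open>r \<noteq> 0\<close> and \<open>A \<noteq> bot\<close>.\<close>

locale gbds_faithful_ideal = gbds_congruence L \<theta> \<I> C J q s t
    for L :: "'l set" and \<theta> :: "'l \<Rightarrow> 'b::generalized_boolean_algebra \<Rightarrow> 'b" and \<I> C J
      and q :: "'r::{comm_ring, comm_monoid_mult} \<Rightarrow> 'b \<Rightarrow> 'x::ring" and s t +
  fixes K
  assumes J_sub_K: "J \<subseteq> K"
    and K_diff: "\<lbrakk>x \<in> K; y \<in> K\<rbrakk> \<Longrightarrow> x - y \<in> K"
    and K_left: "\<lbrakk>z \<in> C; x \<in> K\<rbrakk> \<Longrightarrow> z * x \<in> K"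
    and K_right: "\<lbrakk>z \<in> C; x \<in> K\<rbrakk> \<Longrightarrow> x * z \<in> K"
    and q_not_K: "\<lbrakk>r \<noteq> 0; A \<noteq> bot\<rbrakk> \<Longrightarrow> q r A \<notin> K"
begin

lemma K_cong: "x \<approx> y \<Longrightarrow> x \<in> K \<Longrightarrow> y \<in> K"
  unfolding cong_def using K_diff[of x "x - y"] J_sub_K by auto

text \<open>
  Otherwise some \<open>B \<le> A\<close> with \<open>B \<noteq> bot\<close> has \<open>Delta L \<theta> B\<close> empty or infinite. Multiplying \<open>x\<close> by
  \<open>q 1 B\<close>, and in the infinite case also by \<open>t \<alpha> D\<close> and \<open>s \<alpha> D\<close> with \<open>D = \<theta> \<alpha> B\<close>, removes the second sum and
  leaves \<open>q r B\<close> or \<open>q r D\<close>.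
\<close>

lemma regular_of_mem:
  assumes x: "x \<in> K" "x \<approx> (\<Sum>(r, A)\<leftarrow>ys. q r A) + (\<Sum>(\<alpha>, B, y)\<leftarrow>zs. s \<alpha> B * y)"
    and zs: "\<And>\<alpha> B y. (\<alpha>, B, y) \<in> set zs \<Longrightarrow> \<alpha> \<in> L \<and> B \<in> \<I> \<alpha> \<and> y \<in> C"
    and ys: "disjoint_list ys" "(r, A) \<in> set ys"
  shows "r = 0 \<or> A \<in> regular_elements L \<theta>"
proof (rule ccontr)
  assume "\<not> (r = 0 \<or> A \<in> regular_elements L \<theta>)"
  then obtain B where r: "r \<noteq> 0" and B: "B \<noteq> bot" "B \<le> A"
    "\<not> (finite (Delta L \<theta> B) \<and> 0 < card (Delta L \<theta> B))"
    unfolding regular_elements_def by blast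
  have "q 1 B * x \<approx> q 1 B * ((\<Sum>(r, A)\<leftarrow>ys. q r A) + (\<Sum>(\<alpha>, B, y)\<leftarrow>zs. s \<alpha> B * y))"
    by (intro cong_left x closed)
  also have "\<dots> = q 1 B * (\<Sum>(r, A)\<leftarrow>ys. q r A) + (\<Sum>(\<alpha>, B', y)\<leftarrow>zs. q 1 B * s \<alpha> B' * y)"
    by (simp add: distrib_left mult.assoc case_prod_unfold flip: sum_list_const_mult)
  also have "\<dots> \<approx> q r B + (\<Sum>(\<alpha>, B', y)\<leftarrow>zs. q 1 B * s \<alpha> B' * y)"
    by (intro cong_add cong_refl q_pick[OF ys B(2)])
  finally have Bx: "q 1 B * x \<approx> q r B + (\<Sum>(\<alpha>, B', y)\<leftarrow>zs. q 1 B * s \<alpha> B' * y)" .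
  have BxK: "q 1 B * x \<in> K" by (intro K_left x closed)
  show False
  proof (cases "Delta L \<theta> B = {}")
    case True
    have "(\<Sum>(\<alpha>, B', y)\<leftarrow>zs. q 1 B * s \<alpha> B' * y) \<in> J"
    proof (rule J_sum_list, clarify)
      fix \<alpha> B' y
      assume "(\<alpha>, B', y) \<in> set zs"
      then show "q 1 B * s \<alpha> B' * y \<in> J"
        using zs True by (intro J_right q_s_bot) (auto simp: Delta_def)
    qed
    then have "q 1 B * x \<approx> q r B + 0"
      using Bx cong_add[OF cong_refl] cong_zero cong_trans by blast
    then show False using K_cong[OF _ BxK, of "q r B"] q_not_K[OF r B(1)] by simp
  next
    case False
    then have "infinite (Delta L \<theta> B)" using B(3) by (auto simp: card_gt_0_iff)
    \<comment> \<open>A label that starts none of the products in the second sum.\<close>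
    then obtain \<alpha> where \<alpha>: "\<alpha> \<in> Delta L \<theta> B" "\<alpha> \<notin> fst ` set zs"
      using finite_subset[of "Delta L \<theta> B" "fst ` set zs"] by blast
    define D where "D = \<theta> \<alpha> B"
    have D: "\<alpha> \<in> L" "D \<in> \<I> \<alpha>" "D \<noteq> bot"
      using \<alpha> by (auto simp: Delta_def D_def theta_ideal)
    have tq: "t \<alpha> D * q r' B \<approx> q r' D * t \<alpha> D" for r'
      unfolding D_def by (rule t_q'[OF D(1) D(2)[unfolded D_def]])
    have "(\<Sum>(\<alpha>', B', y)\<leftarrow>zs. t \<alpha> D * (q 1 B * s \<alpha>' B' * y) * s \<alpha> D) \<in> J"
    proof (rule J_sum_list, clarify)
      fix \<alpha>' B' y
      assume z: "(\<alpha>', B', y) \<in> set zs"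
      then have ne: "\<alpha> \<noteq> \<alpha>'" using \<alpha>(2) by force
      have "t \<alpha> D * q 1 B * s \<alpha>' B' \<approx> q 1 D * t \<alpha> D * s \<alpha>' B'"
        using zs z by (intro cong_right tq closed) auto
      moreover have "q 1 D * (t \<alpha> D * s \<alpha>' B') \<in> J"
        using zs z D ne by (intro J_left t_s_diff closed) auto
      ultimately have "t \<alpha> D * q 1 B * s \<alpha>' B' \<in> J"
        using cong_J by (simp add: mult.assoc)
      then have "t \<alpha> D * q 1 B * s \<alpha>' B' * y * s \<alpha> D \<in> J"
        using J_right[OF s_C[OF D(1,2)] J_right[of y]] zs[OF z] by blast
      then show "t \<alpha> D * (q 1 B * s \<alpha>' B' * y) * s \<alpha> D \<in> J"
        by (simp add: mult.assoc)
    qed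
    then have rest: "(\<Sum>(\<alpha>', B', y)\<leftarrow>zs. t \<alpha> D * (q 1 B * s \<alpha>' B' * y) * s \<alpha> D) \<approx> 0"
      by (simp add: cong_zero)
    have "t \<alpha> D * (q 1 B * x) * s \<alpha> D
        \<approx> t \<alpha> D * (q r B + (\<Sum>(\<alpha>', B', y)\<leftarrow>zs. q 1 B * s \<alpha>' B' * y)) * s \<alpha> D"
      using D by (intro cong_left cong_right Bx closed)
    also have "\<dots> = t \<alpha> D * q r B * s \<alpha> D
        + (\<Sum>(\<alpha>', B', y)\<leftarrow>zs. t \<alpha> D * (q 1 B * s \<alpha>' B' * y) * s \<alpha> D)"
      by (simp add: distrib_left distrib_right case_prod_unfold flip: sum_list_const_mult sum_list_mult_const)
    also have "\<dots> \<approx> q r D * t \<alpha> D * s \<alpha> D + 0"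
      using D rest by (intro cong_add cong_right tq closed)
    also have "\<dots> = q r D * (t \<alpha> D * s \<alpha> D)" by (simp add: mult.assoc)
    also have "\<dots> \<approx> q r D * q 1 (inf D D)"
      using D by (intro cong_left t_s' closed)
    also have "\<dots> \<approx> q r D" using q_inf'[of r D 1 D] by simp
    finally have "t \<alpha> D * (q 1 B * x) * s \<alpha> D \<approx> q r D" .
    moreover have "t \<alpha> D * (q 1 B * x) * s \<alpha> D \<in> K"
      using D by (intro K_left K_right BxK closed)
    ultimately show False using K_cong q_not_K r D(3) by blast
  qed
qed

lemma degree_0:
  assumes "x \<in> K" "x \<approx> sum_list ms" "\<And>m. m \<in> set ms \<Longrightarrow> \<exists>i\<le>N. monomial i i m"
  shows "x \<in> J"
  using assms
proof (induction N arbitrary: x ms)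
  case 0
  obtain xs where "sum_list ms = (\<Sum>(r, A)\<leftarrow>xs. q r A)"
    using split_monomials[of ms 0] 0(3) by auto
  then obtain ys where ys: "disjoint_list ys" "x \<approx> (\<Sum>(r, A)\<leftarrow>ys. q r A)"
    using disjoint_form[of xs] cong_trans[OF 0(2)] by auto
  have "q r A \<in> J" if "(r, A) \<in> set ys" for r A
  proof -
    have "q 1 A * x \<approx> q 1 A * (\<Sum>(r, A)\<leftarrow>ys. q r A)" by (intro cong_left ys closed)
    also have "\<dots> \<approx> q r A" by (rule q_pick[OF ys(1) that order_refl])
    finally have "q r A \<in> K" using K_cong K_left[OF q_C 0(1)] by blast
    then have "r = 0 \<or> A = bot" using q_not_K by blast
    then show ?thesis using q_zero q_bot J_zero by auto
  qed
  then have "(\<Sum>(r, A)\<leftarrow>ys. q r A) \<in> J" by (intro J_sum_list) auto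
  then show ?case using ys cong_J by blast
next
  case (Suc N)
  have tms: "t \<alpha> B * x * s \<beta> B' \<in> J" if ab: "\<alpha> \<in> L" "B \<in> \<I> \<alpha>" "\<beta> \<in> L" "B' \<in> \<I> \<beta>" for \<alpha> B \<beta> B'
  proof -
    have "t \<alpha> B * x * s \<beta> B' \<approx> t \<alpha> B * sum_list ms * s \<beta> B'"
      using ab by (intro cong_left cong_right Suc.prems(2) closed)
    also have "\<dots> = (\<Sum>m\<leftarrow>ms. t \<alpha> B * m * s \<beta> B')"
      by (simp add: sum_list_mult_const sum_list_const_mult[of _ "\<lambda>x. x", simplified])
    finally have *: "t \<alpha> B * x * s \<beta> B' \<approx> (\<Sum>m\<leftarrow>ms. t \<alpha> B * m * s \<beta> B')" .
    have "\<exists>m'. (\<exists>i\<le>N. monomial i i m') \<and> t \<alpha> B * m * s \<beta> B' \<approx> m'" if "m \<in> set ms" for m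
      using Suc.prems(3)[OF that] t_monomials_s ab by blast
    then obtain ms' where "\<forall>m\<in>set ms'. \<exists>i\<le>N. monomial i i m"
      "(\<Sum>m\<leftarrow>ms. t \<alpha> B * m * s \<beta> B') \<approx> sum_list ms'"
      using cong_sum_list_ex[of ms "\<lambda>m. \<exists>i\<le>N. monomial i i m" "\<lambda>m. t \<alpha> B * m * s \<beta> B'"] by blast
    moreover have "t \<alpha> B * x * s \<beta> B' \<in> K"
      using ab Suc.prems(1) by (intro K_left K_right closed)
    ultimately show ?thesis using Suc.IH * cong_trans by blast
  qed
  obtain xs zs where xz: "\<forall>(\<alpha>, B, y, \<beta>, B')\<in>set zs. \<alpha> \<in> L \<and> B \<in> \<I> \<alpha> \<and> y \<in> C \<and> \<beta> \<in> L \<and> B' \<in> \<I> \<beta>"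
    "sum_list ms = (\<Sum>(r, A)\<leftarrow>xs. q r A) + (\<Sum>(\<alpha>, B, y, \<beta>, B')\<leftarrow>zs. s \<alpha> B * y * t \<beta> B')"
    using split_monomials[of ms "Suc N"] Suc.prems(3) by blast
  obtain ys where ys: "disjoint_list ys" "(\<Sum>(r, A)\<leftarrow>xs. q r A) \<approx> (\<Sum>(r, A)\<leftarrow>ys. q r A)"
    using disjoint_form by blast
  have x: "x \<approx> (\<Sum>(r, A)\<leftarrow>ys. q r A) + (\<Sum>(\<alpha>, B, y, \<beta>, B')\<leftarrow>zs. s \<alpha> B * y * t \<beta> B')"
    using cong_trans[OF Suc.prems(2)] xz(2) cong_add[OF ys(2) cong_refl] by simp
  have "r = 0 \<or> A \<in> regular_elements L \<theta>" if "(r, A) \<in> set ys" for r A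
  proof (rule regular_of_mem[OF Suc.prems(1) _ _ ys(1) that])
    let ?zs = "map (\<lambda>(\<alpha>, B, y, \<beta>, B'). (\<alpha>, B, y * t \<beta> B')) zs"
    show "x \<approx> (\<Sum>(r, A)\<leftarrow>ys. q r A) + (\<Sum>(\<alpha>, B, y)\<leftarrow>?zs. s \<alpha> B * y)"
      using x by (simp add: comp_def case_prod_unfold mult.assoc)
    show "\<alpha> \<in> L \<and> B \<in> \<I> \<alpha> \<and> y \<in> C" if "(\<alpha>, B, y) \<in> set ?zs" for \<alpha> B y
      using that xz(1) by (fastforce simp: closed)
  qed
  then obtain zs' where zs': "\<forall>(\<alpha>, B, y, \<beta>, B')\<in>set zs'. \<alpha> \<in> L \<and> B \<in> \<I> \<alpha> \<and> y \<in> C \<and> \<beta> \<in> L \<and> B' \<in> \<I> \<beta>"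
    "(\<Sum>(r, A)\<leftarrow>ys. q r A) \<approx> (\<Sum>(\<alpha>, B, y, \<beta>, B')\<leftarrow>zs'. s \<alpha> B * y * t \<beta> B')"
    using regular_sum[of ys] by blast
  show ?case
  proof (rule two_sided_detect)
    show "x \<approx> (\<Sum>(\<alpha>, B, y, \<beta>, B')\<leftarrow>zs' @ zs. s \<alpha> B * y * t \<beta> B')"
      using cong_trans[OF x cong_add[OF zs'(2) cong_refl]] by simp
    show "\<alpha> \<in> L \<and> B \<in> \<I> \<alpha> \<and> y \<in> C \<and> \<beta> \<in> L \<and> B' \<in> \<I> \<beta>"
      if "(\<alpha>, B, y, \<beta>, B') \<in> set (zs' @ zs)" for \<alpha> B y \<beta> B'
      using that xz(1) zs'(1) by auto
  qed (rule tms)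
qed

lemma degree_nonneg:
  assumes "x \<in> K" "x \<approx> sum_list ms" "\<And>m. m \<in> set ms \<Longrightarrow> \<exists>j. monomial (j + n) j m"
  shows "x \<in> J"
  using assms
proof (induction n arbitrary: x ms)
  case 0
  have "\<exists>N. \<forall>m\<in>set ms. \<exists>i\<le>N. monomial i i m"
    using 0(3)
  proof (induction ms)
    case (Cons m ms)
    then obtain N i where "\<forall>m\<in>set ms. \<exists>i\<le>N. monomial i i m" "monomial i i m"
      by (metis add_0_right list.set_intros)
    then show ?case by (intro exI[of _ "max i N"]) (auto simp: le_max_iff_disj)
  qed simp
  then show ?case using degree_0 0 by blast
next
  case (Suc n)
  have form: "m = 0 \<or> (\<exists>\<alpha> B z. \<alpha> \<in> L \<and> B \<in> \<I> \<alpha> \<and> z \<in> C \<and> m = s \<alpha> B * z)" if "m \<in> set ms" for m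
    using Suc.prems(3)[OF that] monomials_left monomials_C by fastforce
  have "\<exists>xs. (\<forall>(\<alpha>, B, y)\<in>set xs. \<alpha> \<in> L \<and> B \<in> \<I> \<alpha> \<and> y \<in> C) \<and> sum_list ms = (\<Sum>(\<alpha>, B, y)\<leftarrow>xs. s \<alpha> B * y)"
    using form
  proof (induction ms)
    case Nil
    show ?case by (rule exI[of _ "[]"]) simp
  next
    case (Cons m ms)
    then obtain xs where xs: "\<forall>(\<alpha>, B, y)\<in>set xs. \<alpha> \<in> L \<and> B \<in> \<I> \<alpha> \<and> y \<in> C"
      "sum_list ms = (\<Sum>(\<alpha>, B, y)\<leftarrow>xs. s \<alpha> B * y)"
      by (metis (no_types, lifting) list.set_intros(2))
    from Cons.prems[OF list.set_intros(1)] show ?case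
    proof (elim disjE exE conjE)
      fix \<alpha> B z
      assume "\<alpha> \<in> L" "B \<in> \<I> \<alpha>" "z \<in> C" "m = s \<alpha> B * z"
      then show ?thesis using xs by (intro exI[of _ "(\<alpha>, B, z) # xs"]) simp
    qed (use xs in auto)
  qed
  then obtain xs where xs: "\<forall>(\<alpha>, B, y)\<in>set xs. \<alpha> \<in> L \<and> B \<in> \<I> \<alpha> \<and> y \<in> C"
    "x \<approx> (\<Sum>(\<alpha>, B, y)\<leftarrow>xs. s \<alpha> B * y)"
    using Suc.prems(2) by auto
  show ?case
  proof (rule left_detect[OF _ xs(2)])
    fix \<alpha> B
    assume ab: "\<alpha> \<in> L" "B \<in> \<I> \<alpha>"
    have *: "t \<alpha> B * x \<approx> (\<Sum>m\<leftarrow>ms. t \<alpha> B * m)"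
      using cong_left[OF Suc.prems(2) t_C[OF ab]] by (simp add: sum_list_const_mult[of _ "\<lambda>x. x", simplified])
    have "\<exists>m'. (\<exists>j. monomial (j + n) j m') \<and> t \<alpha> B * m \<approx> m'" if "m \<in> set ms" for m
      using Suc.prems(3)[OF that] t_monomials[OF _ _ ab] by fastforce
    then obtain ms' where "\<forall>m\<in>set ms'. \<exists>j. monomial (j + n) j m" "(\<Sum>m\<leftarrow>ms. t \<alpha> B * m) \<approx> sum_list ms'"
      using cong_sum_list_ex[of ms "\<lambda>m. \<exists>j. monomial (j + n) j m" "\<lambda>m. t \<alpha> B * m"] by blast
    then show "t \<alpha> B * x \<in> J"
      using Suc.IH[OF K_left[OF t_C[OF ab] Suc.prems(1)]] * cong_trans by blast
  qed (use xs in auto)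
qed

lemma degree_nonpos:
  assumes "x \<in> K" "x \<approx> sum_list ms" "\<And>m. m \<in> set ms \<Longrightarrow> \<exists>i. monomial i (i + n) m"
  shows "x \<in> J"
  using assms
proof (induction n arbitrary: x ms)
  case 0
  then show ?case using degree_nonneg[of x ms 0] by simp
next
  case (Suc n)
  have form: "m = 0 \<or> (\<exists>\<beta> B z. \<beta> \<in> L \<and> B \<in> \<I> \<beta> \<and> z \<in> C \<and> m = z * t \<beta> B)" if "m \<in> set ms" for m
    using Suc.prems(3)[OF that] monomials_right monomials_C by fastforce
  have "\<exists>xs. (\<forall>(\<beta>, B, y)\<in>set xs. \<beta> \<in> L \<and> B \<in> \<I> \<beta> \<and> y \<in> C) \<and> sum_list ms = (\<Sum>(\<beta>, B, y)\<leftarrow>xs. y * t \<beta> B)"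
    using form
  proof (induction ms)
    case Nil
    show ?case by (rule exI[of _ "[]"]) simp
  next
    case (Cons m ms)
    then obtain xs where xs: "\<forall>(\<beta>, B, y)\<in>set xs. \<beta> \<in> L \<and> B \<in> \<I> \<beta> \<and> y \<in> C"
      "sum_list ms = (\<Sum>(\<beta>, B, y)\<leftarrow>xs. y * t \<beta> B)"
      by (metis (no_types, lifting) list.set_intros(2))
    from Cons.prems[OF list.set_intros(1)] show ?case
    proof (elim disjE exE conjE)
      fix \<beta> B z
      assume "\<beta> \<in> L" "B \<in> \<I> \<beta>" "z \<in> C" "m = z * t \<beta> B"
      then show ?thesis using xs by (intro exI[of _ "(\<beta>, B, z) # xs"]) simp
    qed (use xs in auto)
  qed
  then obtain xs where xs: "\<forall>(\<beta>, B, y)\<in>set xs. \<beta> \<in> L \<and> B \<in> \<I> \<beta> \<and> y \<in> C"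
    "x \<approx> (\<Sum>(\<beta>, B, y)\<leftarrow>xs. y * t \<beta> B)"
    using Suc.prems(2) by auto
  show ?case
  proof (rule right_detect[OF _ xs(2)])
    fix \<beta> B
    assume ab: "\<beta> \<in> L" "B \<in> \<I> \<beta>"
    have *: "x * s \<beta> B \<approx> (\<Sum>m\<leftarrow>ms. m * s \<beta> B)"
      using cong_right[OF Suc.prems(2) s_C[OF ab]] by (simp add: sum_list_mult_const[of "\<lambda>x. x", simplified])
    have "\<exists>m'. (\<exists>i. monomial i (i + n) m') \<and> m * s \<beta> B \<approx> m'" if "m \<in> set ms" for m
      using Suc.prems(3)[OF that] monomials_s[OF _ _ ab] by fastforce
    then obtain ms' where "\<forall>m\<in>set ms'. \<exists>i. monomial i (i + n) m" "(\<Sum>m\<leftarrow>ms. m * s \<beta> B) \<approx> sum_list ms'"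
      using cong_sum_list_ex[of ms "\<lambda>m. \<exists>i. monomial i (i + n) m" "\<lambda>m. m * s \<beta> B"] by blast
    then show "x * s \<beta> B \<in> J"
      using Suc.IH[OF K_right[OF s_C[OF ab] Suc.prems(1)]] * cong_trans by blast
  qed (use xs in auto)
qed

theorem homogeneous_mem_J:
  assumes "x \<in> K" "x \<approx> sum_list ms" "set ms \<subseteq> homogeneous_monomials n"
  shows "x \<in> J"
proof (cases "0 \<le> n")
  case True
  have "\<exists>j. monomial (j + nat n) j m" if m: "m \<in> set ms" for m
  proof -
    obtain i j where "monomial i j m" "int i - int j = n"
      using m assms(3) unfolding homogeneous_monomials_def by blast
    then have "i = j + nat n" using True by linarith
    then show ?thesis using \<open>monomial i j m\<close> by blast
  qed
  then show ?thesis using degree_nonneg assms by blast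
next
  case False
  have "\<exists>i. monomial i (i + nat (- n)) m" if m: "m \<in> set ms" for m
  proof -
    obtain i j where "monomial i j m" "int i - int j = n"
      using m assms(3) unfolding homogeneous_monomials_def by blast
    then have "j = i + nat (- n)" using False by linarith
    then show ?thesis using \<open>monomial i j m\<close> by blast
  qed
  then show ?thesis using degree_nonpos assms by blast
qed

end

section \<open>Characters\<close>

text \<open>
  The indicator functions of prime filters. The zero function is admitted.
\<close>

definition character :: "('b::generalized_boolean_algebra \<Rightarrow> bool) \<Rightarrow> bool" where
  "character \<chi> \<longleftrightarrow> \<not> \<chi> bot \<and>
     (\<forall>x y. (\<chi> (sup x y) \<longleftrightarrow> \<chi> x \<or> \<chi> y) \<and> (\<chi> (inf x y) \<longleftrightarrow> \<chi> x \<and> \<chi> y))"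

text \<open>The empty set is admitted.\<close>

definition proper_filter :: "'b::generalized_boolean_algebra set \<Rightarrow> bool" where
  "proper_filter F \<longleftrightarrow> bot \<notin> F \<and> (\<forall>x\<in>F. \<forall>y. x \<le> y \<longrightarrow> y \<in> F) \<and> (\<forall>x\<in>F. \<forall>y\<in>F. inf x y \<in> F)"

lemma proper_filter_extends_to_character:
  assumes "proper_filter F"
  shows "\<exists>\<chi>. character \<chi> \<and> (\<forall>x\<in>F. \<chi> x)"
proof -
  let ?A = "{U. F \<subseteq> U \<and> proper_filter U}"
  have "\<exists>M\<in>?A. \<forall>X\<in>?A. M \<subseteq> X \<longrightarrow> X = M"
  proof (rule subset_Zorn_nonempty)
    show "?A \<noteq> {}" using assms by blast
    fix \<C>
    assume c: "\<C> \<noteq> {}" "subset.chain ?A \<C>"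
    have sub: "\<C> \<subseteq> ?A" and tot: "\<forall>U\<in>\<C>. \<forall>V\<in>\<C>. U \<subseteq> V \<or> V \<subseteq> U"
      using conjunct1[OF c(2)[unfolded subset_chain_def]] conjunct2[OF c(2)[unfolded subset_chain_def]]
      by simp_all
    have filter: "bot \<notin> U" "\<And>x y. x \<in> U \<Longrightarrow> x \<le> y \<Longrightarrow> y \<in> U"
      "\<And>x y. x \<in> U \<Longrightarrow> y \<in> U \<Longrightarrow> inf x y \<in> U" if "U \<in> \<C>" for U
    proof -
      have "proper_filter U" using sub that by blast
      then show "bot \<notin> U" "\<And>x y. x \<in> U \<Longrightarrow> x \<le> y \<Longrightarrow> y \<in> U"
        "\<And>x y. x \<in> U \<Longrightarrow> y \<in> U \<Longrightarrow> inf x y \<in> U"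
        by (simp_all add: proper_filter_def)
    qed
    have "proper_filter (\<Union>\<C>)"
      unfolding proper_filter_def
    proof (intro conjI ballI allI impI)
      show "bot \<notin> \<Union>\<C>" using filter(1) by blast
    next
      fix x y
      assume "x \<in> \<Union>\<C>" "x \<le> y"
      then show "y \<in> \<Union>\<C>" using filter(2) by (elim UnionE) (rule UnionI)
    next
      fix x y
      assume "x \<in> \<Union>\<C>" "y \<in> \<Union>\<C>"
      then obtain U V where UV: "U \<in> \<C>" "x \<in> U" "V \<in> \<C>" "y \<in> V" by (elim UnionE)
      then have "U \<subseteq> V \<or> V \<subseteq> U" using tot by simp
      then obtain W where "W \<in> \<C>" "x \<in> W" "y \<in> W" using UV by (elim disjE) (simp_all add: subset_iff)
      then show "inf x y \<in> \<Union>\<C>" using filter(3)[of W x y] by (intro UnionI)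
    qed
    moreover obtain U where "U \<in> \<C>" using c(1) by (meson ex_in_conv)
    then have "F \<subseteq> \<Union>\<C>" using sub by (intro order_trans[OF _ Union_upper]) auto
    ultimately show "\<Union>\<C> \<in> ?A" by simp
  qed
  then obtain M where M: "F \<subseteq> M" "proper_filter M"
    and max: "\<And>X. F \<subseteq> X \<Longrightarrow> proper_filter X \<Longrightarrow> M \<subseteq> X \<Longrightarrow> X = M"
    by auto
  have Mup: "\<And>x y. x \<in> M \<Longrightarrow> x \<le> y \<Longrightarrow> y \<in> M" and Minf: "\<And>x y. x \<in> M \<Longrightarrow> y \<in> M \<Longrightarrow> inf x y \<in> M"
    and Mbot: "bot \<notin> M"
    using M(2) by (auto simp: proper_filter_def)
  have meet: "\<exists>m\<in>M. inf m x = bot" if "x \<notin> M" "M \<noteq> {}" for x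
  proof (rule ccontr)
    assume ne: "\<not> (\<exists>m\<in>M. inf m x = bot)"
    let ?X = "{z. \<exists>m\<in>M. inf m x \<le> z}"
    have "inf u v \<in> ?X" if uv: "u \<in> ?X" "v \<in> ?X" for u v
    proof -
      obtain m m' where m: "m \<in> M" "m' \<in> M" "inf m x \<le> u" "inf m' x \<le> v"
        using uv by blast
      have "inf (inf m m') x \<le> u" "inf (inf m m') x \<le> v"
        by (rule order_trans[OF inf_mono[OF inf_le1 order_refl] m(3)],
            rule order_trans[OF inf_mono[OF inf_le2 order_refl] m(4)])
      then have "inf (inf m m') x \<le> inf u v" by simp
      then show ?thesis using Minf m by blast
    qed
    moreover have "v \<in> ?X" if "u \<in> ?X" "u \<le> v" for u v
      using that order_trans[of _ u v] by blast
    moreover have "bot \<notin> ?X" using ne by (simp add: bot_unique)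
    ultimately have "proper_filter ?X" unfolding proper_filter_def by blast
    moreover have "M \<subseteq> ?X" using inf_le1 by blast
    ultimately have "?X = M" using max M(1) by blast
    moreover have "x \<in> ?X" using that(2) inf_le2 by blast
    ultimately show False using that(1) by simp
  qed
  have prime: "x \<in> M \<or> y \<in> M" if xy: "sup x y \<in> M" for x y
  proof (rule ccontr)
    assume "\<not> (x \<in> M \<or> y \<in> M)"
    then obtain m m' where m: "m \<in> M" "m' \<in> M" "inf m x = bot" "inf m' y = bot"
      using meet[of x] meet[of y] xy by blast
    have "inf (inf m m') (sup x y) = sup (inf m' (inf m x)) (inf m (inf m' y))"
      by (simp add: inf_sup_distrib1 inf.assoc inf.left_commute)
    also have "\<dots> = bot" using m by simp
    finally show False using Minf[OF Minf[OF m(1,2)] xy] Mbot by simp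
  qed
  have "character (\<lambda>x. x \<in> M)"
    unfolding character_def
  proof (intro conjI allI iffI)
    show "bot \<notin> M" by (rule Mbot)
    fix x y
    show "sup x y \<in> M" if "x \<in> M \<or> y \<in> M"
      using that Mup[OF _ sup_ge1] Mup[OF _ sup_ge2] by auto
    show "x \<in> M" "y \<in> M" if "inf x y \<in> M"
      using Mup[OF that inf_le1] Mup[OF that inf_le2] by auto
  qed (use prime Minf in blast)+
  then show ?thesis using M(1) by blast
qed

lemma character_exists:
  assumes "A \<noteq> bot"
  shows "\<exists>\<chi>. character \<chi> \<and> \<chi> A"
proof -
  have "proper_filter {x. A \<le> x}"
    using assms unfolding proper_filter_def by (auto intro: order_trans simp: bot_unique)
  then show ?thesis using proper_filter_extends_to_character by blast
qed

section \<open>Branching systems\<close>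

context generalized_boolean_dynamical_system
begin

lemma character_theta: "\<alpha> \<in> L \<Longrightarrow> character \<chi> \<Longrightarrow> character (\<chi> \<circ> \<theta> \<alpha>)"
  unfolding character_def by (simp add: theta_bot theta_sup theta_inf)

text \<open>
  By finiteness of \<open>\<Delta>\<^sub>A\<close>, some \<open>\<theta>\<^sub>\<alpha>\<close> maps no element of the filter \<open>\<chi>\<close> to \<open>bot\<close>. A character that
  contains the image of \<open>\<chi>\<close> then restricts to \<open>\<chi>\<close>, as prime filters are maximal.
\<close>

lemma regular_character_has_edge:
  assumes "A \<in> regular_elements L \<theta>" and \<chi>: "character \<chi>" "\<chi> A"
  shows "\<exists>\<alpha>\<in>L. \<exists>\<chi>'. character \<chi>' \<and> \<chi>' \<circ> \<theta> \<alpha> = \<chi>"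
proof -
  have \<chi>_inf: "\<And>x y. \<chi> (inf x y) \<longleftrightarrow> \<chi> x \<and> \<chi> y" and \<chi>_sup: "\<And>x y. \<chi> (sup x y) \<longleftrightarrow> \<chi> x \<or> \<chi> y"
    and \<chi>_bot: "\<not> \<chi> bot"
    using \<chi>(1) unfolding character_def by blast+
  have fin: "finite (Delta L \<theta> A)"
    using assms unfolding regular_elements_def character_def by (cases "A = bot") auto
  have "\<exists>\<alpha>\<in>L. \<forall>D. \<chi> D \<longrightarrow> \<theta> \<alpha> D \<noteq> bot"
  proof (rule ccontr)
    assume "\<not> ?thesis"
    then obtain c where c: "\<And>\<alpha>. \<alpha> \<in> L \<Longrightarrow> \<chi> (c \<alpha>) \<and> \<theta> \<alpha> (c \<alpha>) = bot"
      by metis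
    have "\<exists>B\<le>A. \<chi> B \<and> (\<forall>\<alpha>\<in>T. \<theta> \<alpha> B = bot)" if "finite T" "T \<subseteq> L" for T
      using that
    proof (induction T)
      case empty
      then show ?case using \<chi> by auto
    next
      case (insert \<alpha> T)
      then obtain B where B: "B \<le> A" "\<chi> B" "\<forall>\<alpha>\<in>T. \<theta> \<alpha> B = bot" by auto
      then have "inf B (c \<alpha>) \<le> A" "\<chi> (inf B (c \<alpha>))" "\<forall>\<beta>\<in>insert \<alpha> T. \<theta> \<beta> (inf B (c \<alpha>)) = bot"
        using insert.prems c by (auto simp: \<chi>_inf theta_inf le_infI1)
      then show ?case by blast
    qed
    from this[OF fin] obtain B where B: "B \<le> A" "\<chi> B" "\<forall>\<alpha>\<in>Delta L \<theta> A. \<theta> \<alpha> B = bot"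
      by (auto simp: Delta_def)
    have "\<theta> \<alpha> B = bot" if "\<alpha> \<in> L" for \<alpha>
    proof (cases "\<alpha> \<in> Delta L \<theta> A")
      case False
      have "\<theta> \<alpha> B = inf (\<theta> \<alpha> B) (\<theta> \<alpha> A)"
        using theta_inf[OF that, of B A] B(1) by (simp add: inf.absorb1)
      then show ?thesis using False that by (simp add: Delta_def)
    qed (use B in blast)
    then have "Delta L \<theta> B = {}" by (auto simp: Delta_def)
    moreover have "B \<noteq> bot" using B \<chi>_bot by auto
    ultimately show False using assms(1) B(1) unfolding regular_elements_def by auto
  qed
  then obtain \<alpha> where \<alpha>: "\<alpha> \<in> L" "\<And>D. \<chi> D \<Longrightarrow> \<theta> \<alpha> D \<noteq> bot" by blast
  let ?F = "{x. \<exists>D. \<chi> D \<and> \<theta> \<alpha> D \<le> x}"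
  have "inf x y \<in> ?F" if xy: "x \<in> ?F" "y \<in> ?F" for x y
  proof -
    obtain D E where "\<chi> D" "\<chi> E" "\<theta> \<alpha> D \<le> x" "\<theta> \<alpha> E \<le> y" using xy by blast
    then have "\<chi> (inf D E)" "\<theta> \<alpha> (inf D E) \<le> inf x y"
      using \<alpha>(1) by (auto simp: \<chi>_inf theta_inf intro: le_infI1 le_infI2)
    then show ?thesis by blast
  qed
  moreover have "y \<in> ?F" if "x \<in> ?F" "x \<le> y" for x y
    using that order_trans[of _ x y] by blast
  moreover have "bot \<notin> ?F" using \<alpha>(2) by (simp add: bot_unique)
  ultimately have "proper_filter ?F" unfolding proper_filter_def by blast
  then obtain \<chi>' where \<chi>': "character \<chi>'" "\<And>D. \<chi> D \<Longrightarrow> \<chi>' (\<theta> \<alpha> D)"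
    using proper_filter_extends_to_character by blast
  have "\<not> \<chi>' (\<theta> \<alpha> D)" if D: "\<not> \<chi> D" for D
  proof
    assume D': "\<chi>' (\<theta> \<alpha> D)"
    \<comment> \<open>Maximality: the filter contains \<open>A\<close> but not \<open>D\<close>, hence \<open>A - D\<close>.\<close>
    have "\<chi> (A - D)" using \<chi>(2) D \<chi>_sup[of "A - D" "inf A D"] \<chi>_inf by (simp add: sup_diff_inf)
    then have "\<chi>' (inf (\<theta> \<alpha> (A - D)) (\<theta> \<alpha> D))"
      using \<chi>'(2) D' \<chi>'(1) unfolding character_def by simp
    moreover have "inf (\<theta> \<alpha> (A - D)) (\<theta> \<alpha> D) = bot"
      using \<alpha>(1) by (simp add: theta_bot inf_diff_bot flip: theta_inf)
    ultimately show False using \<chi>'(1) unfolding character_def by simp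
  qed
  then have "\<chi>' \<circ> \<theta> \<alpha> = \<chi>" using \<chi>'(2) by (auto simp: fun_eq_iff)
  then show ?thesis using \<alpha>(1) \<chi>'(1) by blast
qed

end

text \<open>
  A type of points \<open>y\<close>, each lying over the character \<open>D y\<close>, with maps \<open>e \<alpha>\<close> along which characters
  are composed with \<open>\<theta> \<alpha>\<close>. On the points whose character is not zero, these maps are injective with
  disjoint images, and the images cover all points whose character contains a regular element.
  Where \<open>D z\<close> is zero, nothing is required of \<open>e \<alpha> z\<close>.
\<close>

locale gbds_branching = generalized_boolean_dynamical_system L \<theta> \<I>
    for L :: "'l set"
      and \<theta> :: "'l \<Rightarrow> 'b::generalized_boolean_algebra \<Rightarrow> 'b"
      and \<I> :: "'l \<Rightarrow> 'b set" +
  fixes D :: "'y \<Rightarrow> 'b \<Rightarrow> bool" and e :: "'l \<Rightarrow> 'y \<Rightarrow> 'y"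
  assumes D_character: "character (D y)"
    and D_e: "\<lbrakk>\<alpha> \<in> L; D z B\<rbrakk> \<Longrightarrow> D (e \<alpha> z) A \<longleftrightarrow> D z (\<theta> \<alpha> A)"
    and e_inj: "\<lbrakk>\<alpha> \<in> L; \<alpha>' \<in> L; D z B; D z' B'; e \<alpha> z = e \<alpha>' z'\<rbrakk> \<Longrightarrow> \<alpha> = \<alpha>' \<and> z = z'"
    and e_regular: "\<lbrakk>A \<in> regular_elements L \<theta>; D y A\<rbrakk> \<Longrightarrow> \<exists>\<alpha>\<in>L. \<exists>z. D z (\<theta> \<alpha> A) \<and> e \<alpha> z = y"

lemma infinite_times_bij:
  fixes g :: "'a \<Rightarrow> 'k"
  assumes "infinite (UNIV :: 'k set)" "inj_on g E" "E \<noteq> {}"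
  shows "\<exists>f. bij_betw f (E \<times> (UNIV :: 'k set)) (UNIV :: 'k set)"
proof -
  have "(card_of E, card_of (UNIV :: 'k set)) \<in> ordLeq"
    using assms(2) by (intro card_of_ordLeq[THEN iffD1]) auto
  from conjunct2[OF card_of_Times_infinite[OF assms(1,3) this]] show ?thesis
    by (rule card_of_ordIso[THEN iffD2])
qed

text \<open>
  The points are pairs \<open>(\<chi>, k)\<close>; such a pair lies over \<open>\<chi>\<close> if \<open>\<chi>\<close> is a character, and over zero
  otherwise. The element \<open>k\<close> ranges over an infinite type \<open>?K\<close> into which the set \<open>E x\<close> of edges
  ending at \<open>x\<close> embeds, and \<open>\<phi> x\<close> identifies \<open>E x \<times> ?K\<close> with the copy of \<open>?K\<close> over \<open>x\<close>.
\<close>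

lemma (in generalized_boolean_dynamical_system) branching_exists:
  "\<exists>(D :: ('b \<Rightarrow> bool) \<times> ('l \<times> ('b \<Rightarrow> bool) + nat) \<Rightarrow> 'b \<Rightarrow> bool) e.
     gbds_branching L \<theta> \<I> D e \<and> (\<forall>A. A \<noteq> bot \<longrightarrow> (\<exists>y. D y A))"
proof -
  define E where "E x = {(\<alpha>, \<chi>). \<alpha> \<in> L \<and> character \<chi> \<and> \<chi> \<circ> \<theta> \<alpha> = x}" for x
  let ?K = "UNIV :: ('l \<times> ('b \<Rightarrow> bool) + nat) set"
  have inf: "infinite ?K"
    by (simp add: finite_Plus_UNIV_iff)
  have inj: "inj_on (Inl :: _ \<Rightarrow> 'l \<times> ('b \<Rightarrow> bool) + nat) (E x)" for x
    by simp
  have ex: "\<exists>f. bij_betw f (E x \<times> ?K) ?K" if "E x \<noteq> {}" for x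
    by (rule infinite_times_bij[OF inf inj that])
  define \<phi> where "\<phi> x = (SOME f. bij_betw f (E x \<times> ?K) ?K)" for x
  have \<phi>: "bij_betw (\<phi> x) (E x \<times> ?K) ?K" if "E x \<noteq> {}" for x
    unfolding \<phi>_def by (rule someI_ex[OF ex[OF that]])
  define D :: "('b \<Rightarrow> bool) \<times> ('l \<times> ('b \<Rightarrow> bool) + nat) \<Rightarrow> 'b \<Rightarrow> bool"
    where "D = (\<lambda>(\<chi>, k) A. character \<chi> \<and> \<chi> A)"
  define e where "e = (\<lambda>\<alpha> (\<chi>, k). (\<chi> \<circ> \<theta> \<alpha>, \<phi> (\<chi> \<circ> \<theta> \<alpha>) ((\<alpha>, \<chi>), k)))"
  have "gbds_branching L \<theta> \<I> D e"
  proof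
    fix y
    show "character (D y)"
      by (cases y) (auto simp: D_def character_def)
  next
    fix \<alpha> z A B
    assume "\<alpha> \<in> L" "D z B"
    then show "D (e \<alpha> z) A \<longleftrightarrow> D z (\<theta> \<alpha> A)"
      by (cases z) (auto simp: D_def e_def character_theta)
  next
    fix \<alpha> \<alpha>' z z' B B'
    assume *: "\<alpha> \<in> L" "\<alpha>' \<in> L" "D z B" "D z' B'" "e \<alpha> z = e \<alpha>' z'"
    obtain \<chi> k \<chi>' k' where z: "z = (\<chi>, k)" "z' = (\<chi>', k')" by (cases z, cases z')
    let ?x = "\<chi> \<circ> \<theta> \<alpha>"
    have x: "?x = \<chi>' \<circ> \<theta> \<alpha>'" "\<phi> ?x ((\<alpha>, \<chi>), k) = \<phi> ?x ((\<alpha>', \<chi>'), k')"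
      using *(5) z by (auto simp: e_def)
    have E: "(\<alpha>, \<chi>) \<in> E ?x" "(\<alpha>', \<chi>') \<in> E ?x"
      using * z x(1) by (auto simp: E_def D_def)
    then have "inj_on (\<phi> ?x) (E ?x \<times> UNIV)"
      by (intro bij_betw_imp_inj_on[OF \<phi>]) (rule notI, simp)
    then show "\<alpha> = \<alpha>' \<and> z = z'"
      using inj_onD[of "\<phi> ?x" "E ?x \<times> UNIV" "((\<alpha>, \<chi>), k)" "((\<alpha>', \<chi>'), k')"] x(2) E z
      by simp
  next
    fix A y
    assume A: "A \<in> regular_elements L \<theta>" "D y A"
    obtain \<chi> k where y: "y = (\<chi>, k)" by (cases y)
    have "E \<chi> \<noteq> {}"
      using regular_character_has_edge[OF A(1), of \<chi>] A(2) y by (auto simp: E_def D_def)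
    then have "\<phi> \<chi> ` (E \<chi> \<times> ?K) = UNIV"
      by (rule bij_betw_imp_surj_on[OF \<phi>])
    then have "k \<in> \<phi> \<chi> ` (E \<chi> \<times> ?K)"
      by (simp only: UNIV_I)
    then obtain \<alpha> \<chi>' k' where *: "(\<alpha>, \<chi>') \<in> E \<chi>" "\<phi> \<chi> ((\<alpha>, \<chi>'), k') = k"
      by auto
    then have "\<alpha> \<in> L" "character \<chi>'" "\<chi>' \<circ> \<theta> \<alpha> = \<chi>"
      by (simp_all add: E_def)
    moreover from this have "D (\<chi>', k') (\<theta> \<alpha> A)" "e \<alpha> (\<chi>', k') = y"
      using A(2) y *(2) by (auto simp: D_def e_def)
    ultimately show "\<exists>\<alpha>\<in>L. \<exists>z. D z (\<theta> \<alpha> A) \<and> e \<alpha> z = y"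
      by blast
  qed
  moreover have "\<exists>y. D y A" if "A \<noteq> bot" for A
    using character_exists[OF that] by (auto simp: D_def)
  ultimately show ?thesis by (intro exI[of _ D] exI[of _ e]) simp
qed

section \<open>The representation on functions on a branching system\<close>

lemma poly_mapping_expand:
  "x = (\<Sum>w\<in>Poly_Mapping.keys x. Poly_Mapping.single w (Poly_Mapping.lookup x w))"
  by (rule poly_mapping_eqI) (simp add: lookup_sum lookup_single when_def in_keys_iff)

context gbds_branching
begin

text \<open>
  \<open>s\<^sub>\<alpha>\<^sub>,\<^sub>B\<close> moves the values of a function along \<open>e \<alpha>\<close>, from the points over \<open>B\<close>, and its adjoint moves
  them back. The choice in the second equation is unique whenever \<open>\<alpha> \<in> L\<close>.
\<close>

fun gen_op :: "('l, 'b) gbds_gen \<Rightarrow> ('y \<Rightarrow> 'r::{comm_ring, comm_monoid_mult}) \<Rightarrow> 'y \<Rightarrow> 'r" where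
  "gen_op (Gen_p A) h y = (if D y A then h y else 0)"
| "gen_op (Gen_s \<alpha> B) h y = (if \<exists>z. D z B \<and> e \<alpha> z = y then h (SOME z. D z B \<and> e \<alpha> z = y) else 0)"
| "gen_op (Gen_s_star \<alpha> B) h y = (if D y B then h (e \<alpha> y) else 0)"

declare gen_op.simps(2) [simp del]

lemma D_bot [simp]: "\<not> D y bot"
  and D_sup [simp]: "D y (sup A B) \<longleftrightarrow> D y A \<or> D y B"
  and D_inf [simp]: "D y (inf A B) \<longleftrightarrow> D y A \<and> D y B"
  using D_character[of y] by (simp_all add: character_def)

lemma gen_op_s:
  assumes "\<alpha> \<in> L" "D z B"
  shows "gen_op (Gen_s \<alpha> B) h (e \<alpha> z) = h z"
proof -
  have "(SOME z'. D z' B \<and> e \<alpha> z' = e \<alpha> z) = z"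
    using assms e_inj by (intro some_equality) blast+
  then show ?thesis using assms by (auto simp: gen_op.simps(2))
qed

lemma gen_op_s_0: "(\<And>z. D z B \<Longrightarrow> e \<alpha> z \<noteq> y) \<Longrightarrow> gen_op (Gen_s \<alpha> B) h y = 0"
  by (auto simp: gen_op.simps(2))

lemma gen_op_linear:
  "gen_op g (\<lambda>y. \<Sum>i\<in>T. c i * h i y) y = (\<Sum>i\<in>T. c i * gen_op g (h i) y)"
proof (cases g)
  case (Gen_s \<alpha> B)
  then show ?thesis
    by (simp add: gen_op.simps(2) del: ex_simps not_ex)
qed auto

text \<open>The first letter of a word acts last.\<close>

definition word_op :: "('l, 'b) gbds_gen list \<Rightarrow> ('y \<Rightarrow> 'r::{comm_ring, comm_monoid_mult}) \<Rightarrow> 'y \<Rightarrow> 'r"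
  where "word_op = foldr gen_op"

lemma word_op_linear:
  "word_op w (\<lambda>y. \<Sum>i\<in>T. c i * h i y) y = (\<Sum>i\<in>T. c i * word_op w (h i) y)"
proof (induction w arbitrary: y)
  case (Cons g w)
  have "word_op w (\<lambda>y. \<Sum>i\<in>T. c i * h i y) = (\<lambda>y. \<Sum>i\<in>T. c i * word_op w (h i) y)"
    by (rule ext, rule Cons.IH)
  then show ?case by (simp add: gen_op_linear word_op_def)
qed (simp add: word_op_def)

text \<open>The action of the free algebra, obtained by linear extension from words.\<close>

definition rep :: "('l, 'b, 'r::{comm_ring, comm_monoid_mult}) gbds_free \<Rightarrow> ('y \<Rightarrow> 'r) \<Rightarrow> 'y \<Rightarrow> 'r"
  where "rep x h y = (\<Sum>w\<in>Poly_Mapping.keys x. Poly_Mapping.lookup x w * word_op (letters w) h y)"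

lemma rep_superset:
  assumes "finite S" "Poly_Mapping.keys x \<subseteq> S"
  shows "rep x h y = (\<Sum>w\<in>S. Poly_Mapping.lookup x w * word_op (letters w) h y)"
  unfolding rep_def using assms by (intro sum.mono_neutral_left) (auto simp: in_keys_iff)

lemma rep_0: "rep 0 h y = 0"
  by (simp add: rep_def)

lemma rep_add: "rep (x + x') h y = rep x h y + rep x' h y"
  using keys_add[of x x']
  by (simp add: rep_superset[of "Poly_Mapping.keys x \<union> Poly_Mapping.keys x'" x]
      rep_superset[of "Poly_Mapping.keys x \<union> Poly_Mapping.keys x'" x']
      rep_superset[of "Poly_Mapping.keys x \<union> Poly_Mapping.keys x'" "x + x'"] lookup_add distrib_right sum.distrib)

lemma rep_diff: "rep (x - x') h y = rep x h y - rep x' h y"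
  using keys_diff[of x x']
  by (simp add: rep_superset[of "Poly_Mapping.keys x \<union> Poly_Mapping.keys x'" x]
      rep_superset[of "Poly_Mapping.keys x \<union> Poly_Mapping.keys x'" x']
      rep_superset[of "Poly_Mapping.keys x \<union> Poly_Mapping.keys x'" "x - x'"] lookup_minus left_diff_distrib sum_subtractf)

lemma rep_sum: "rep (\<Sum>i\<in>T. x i) h y = (\<Sum>i\<in>T. rep (x i) h y)"
  by (induction T rule: infinite_finite_induct) (auto simp: rep_0 rep_add)

lemma rep_single: "rep (Poly_Mapping.single w r) h y = r * word_op (letters w) h y"
  using rep_superset[of "{w}" "Poly_Mapping.single w r"] by (simp split: if_splits)

lemma rep_mult: "rep (x * x') h y = rep x (rep x' h) y"
proof -
  let ?x = "Poly_Mapping.lookup x" and ?x' = "Poly_Mapping.lookup x'"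
  have "x * x' = (\<Sum>u\<in>Poly_Mapping.keys x. Poly_Mapping.single u (?x u)) *
      (\<Sum>v\<in>Poly_Mapping.keys x'. Poly_Mapping.single v (?x' v))"
    by (simp flip: poly_mapping_expand)
  also have "\<dots> = (\<Sum>u\<in>Poly_Mapping.keys x. \<Sum>v\<in>Poly_Mapping.keys x'.
      Poly_Mapping.single (u + v) (?x u * ?x' v))"
    by (simp add: sum_product mult_single)
  finally have "x * x' = \<dots>" .
  then have "rep (x * x') h y = (\<Sum>u\<in>Poly_Mapping.keys x. \<Sum>v\<in>Poly_Mapping.keys x'.
      ?x u * ?x' v * word_op (letters u @ letters v) h y)"
    by (simp add: rep_sum rep_single plus_free_word_def)
  also have "\<dots> = (\<Sum>u\<in>Poly_Mapping.keys x. ?x u * (\<Sum>v\<in>Poly_Mapping.keys x'.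
      ?x' v * word_op (letters u) (word_op (letters v) h) y))"
    by (simp add: sum_distrib_left mult.assoc word_op_def)
  also have "\<dots> = rep x (rep x' h) y"
  proof -
    have "rep x' h = (\<lambda>y. \<Sum>v\<in>Poly_Mapping.keys x'. ?x' v * word_op (letters v) h y)"
      by (simp add: rep_def fun_eq_iff)
    then show ?thesis by (simp add: rep_def[of x] word_op_linear)
  qed
  finally show ?thesis .
qed

lemma rep_gen: "rep (free_gen g) = gen_op g"
  by (intro ext) (simp add: free_gen_def rep_single word_op_def)

lemma rep_scale: "rep (Poly_Mapping.map ((*) r) x) h y = r * rep x h y"
proof -
  have "Poly_Mapping.keys (Poly_Mapping.map ((*) r) x) \<subseteq> Poly_Mapping.keys x"
    by (auto simp: in_keys_iff map.rep_eq when_def)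
  then show ?thesis
    using rep_superset[of "Poly_Mapping.keys x" "Poly_Mapping.map ((*) r) x"]
    unfolding rep_def sum_distrib_left
    by (auto simp: map.rep_eq when_def mult.assoc in_keys_iff intro!: sum.cong)
qed

text \<open>The operators satisfy the defining relations.\<close>

lemma rep_rel:
  fixes x x' :: "('l, 'b, 'r::{comm_ring, comm_monoid_mult}) gbds_free"
  assumes "gbds_rel L \<theta> \<I> x x'"
  shows "rep x h y = rep x' h y"
  using assms
proof cases
  case p_bot
  then show ?thesis by (simp add: rep_gen rep_0)
next
  case (p_inf A A')
  then show ?thesis by (simp add: rep_gen rep_mult)
next
  case (p_sup A A')
  then show ?thesis by (simp add: rep_gen rep_add rep_diff)
next
  case (p_s \<alpha> B A)
  show ?thesis
  proof (cases "\<exists>z. D z B \<and> e \<alpha> z = y")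
    case True
    then obtain z where "D z B" "y = e \<alpha> z" by blast
    then show ?thesis using p_s by (simp add: rep_gen rep_mult gen_op_s D_e)
  next
    case False
    then have "gen_op (Gen_s \<alpha> B) h' y = 0" for h' :: "'y \<Rightarrow> 'r"
      by (intro gen_op_s_0) blast
    then show ?thesis using p_s by (simp add: rep_gen rep_mult)
  qed
next
  case (s_star_p \<alpha> B A)
  then show ?thesis by (simp add: rep_gen rep_mult D_e)
next
  case (s_star_s \<alpha> B \<alpha>' B')
  show ?thesis
  proof (cases "D y B \<and> \<alpha> = \<alpha>' \<and> D y B'")
    case True
    then show ?thesis using s_star_s by (simp add: rep_gen rep_mult gen_op_s)
  next
    case False
    have "gen_op (Gen_s \<alpha>' B') h (e \<alpha> y) = 0" if "D y B"
    proof (rule gen_op_s_0)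
      fix z
      assume "D z B'"
      then show "e \<alpha>' z \<noteq> e \<alpha> y"
        using False that e_inj[OF s_star_s(5,3), of z B' y B] by auto
    qed
    then have "rep x h y = 0" by (simp add: s_star_s rep_gen rep_mult)
    moreover have "rep x' h y = 0" using False by (auto simp: s_star_s rep_gen rep_0)
    ultimately show ?thesis by simp
  qed
next
  case (s_p \<alpha> B B')
  show ?thesis
  proof (cases "\<exists>z. D z B \<and> e \<alpha> z = y")
    case True
    then obtain z where z: "D z B" "e \<alpha> z = y" by blast
    show ?thesis
    proof (cases "D z B'")
      case True
      then have "D z (inf B B')" using z by simp
      then have "gen_op (Gen_s \<alpha> (inf B B')) h y = h z"
        using gen_op_s[OF s_p(3)] z(2) by metis
      moreover have "gen_op (Gen_s \<alpha> B) h' y = h' z" for h' :: "'y \<Rightarrow> 'r"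
        using gen_op_s[OF s_p(3) z(1)] z(2) by metis
      ultimately show ?thesis by (simp add: s_p(1,2) rep_gen rep_mult True)
    next
      case False
      have "gen_op (Gen_s \<alpha> (inf B B')) h y = 0"
      proof (rule gen_op_s_0)
        fix z'
        assume "D z' (inf B B')"
        then have z': "D z' B" "D z' B'" by simp_all
        show "e \<alpha> z' \<noteq> y"
        proof
          assume "e \<alpha> z' = y"
          then have "z' = z" using e_inj[OF s_p(3,3) z'(1) z(1)] z(2) by simp
          then show False using False z'(2) by simp
        qed
      qed
      moreover have "gen_op (Gen_s \<alpha> B) h' y = h' z" for h' :: "'y \<Rightarrow> 'r"
        using gen_op_s[OF s_p(3) z(1)] z(2) by simp
      ultimately show ?thesis by (simp add: s_p(1,2) rep_gen rep_mult False)
    qed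
  next
    case False
    then have *: "e \<alpha> z \<noteq> y" if "D z B" for z
      using that by blast
    have "gen_op (Gen_s \<alpha> (inf B B')) h y = 0"
      by (rule gen_op_s_0, rule *) simp
    moreover have "gen_op (Gen_s \<alpha> B) h' y = 0" for h' :: "'y \<Rightarrow> 'r"
      by (rule gen_op_s_0, rule *)
    ultimately show ?thesis using s_p by (simp add: rep_gen rep_mult)
  qed
next
  case (p_s_star \<alpha> B B')
  then show ?thesis by (simp add: rep_gen rep_mult)
next
  case (p_regular A)
  have eq: "rep x' h y = (\<Sum>\<alpha>\<in>Delta L \<theta> A. gen_op (Gen_s \<alpha> (\<theta> \<alpha> A)) (gen_op (Gen_s_star \<alpha> (\<theta> \<alpha> A)) h) y)"
    using p_regular by (simp add: rep_sum rep_mult rep_gen)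
  show ?thesis
  proof (cases "D y A")
    case True
    then obtain \<alpha> z where z: "\<alpha> \<in> L" "D z (\<theta> \<alpha> A)" "e \<alpha> z = y"
      using e_regular p_regular by blast
    have \<alpha>: "\<alpha> \<in> Delta L \<theta> A"
      using z by (auto simp: Delta_def)
    have "A \<noteq> bot"
      using True by auto
    then have "finite (Delta L \<theta> A)"
      using p_regular by (simp add: regular_elements_def)
    moreover have "gen_op (Gen_s \<beta> (\<theta> \<beta> A)) (gen_op (Gen_s_star \<beta> (\<theta> \<beta> A)) h) y = 0"
      if "\<beta> \<in> Delta L \<theta> A - {\<alpha>}" for \<beta>
      using that z e_inj[of \<beta> \<alpha>] by (intro gen_op_s_0) (auto simp: Delta_def)
    ultimately have "rep x' h y = gen_op (Gen_s \<alpha> (\<theta> \<alpha> A)) (gen_op (Gen_s_star \<alpha> (\<theta> \<alpha> A)) h) y"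
      unfolding eq using \<alpha> by (simp add: sum.remove)
    also have "\<dots> = h y" using z by (auto simp: gen_op_s)
    finally show ?thesis using True p_regular by (simp add: rep_gen)
  next
    case False
    have "gen_op (Gen_s \<alpha> (\<theta> \<alpha> A)) (gen_op (Gen_s_star \<alpha> (\<theta> \<alpha> A)) h) y = 0"
      if "\<alpha> \<in> Delta L \<theta> A" for \<alpha>
      using that False D_e[of \<alpha>] by (intro gen_op_s_0) (auto simp: Delta_def)
    then show ?thesis using False p_regular eq by (simp add: rep_gen)
  qed
qed

end

section \<open>Ideals of the free algebra\<close>

text \<open>Scalar multiplication in the free algebra.\<close>

abbreviation scale :: "'r::{comm_ring, comm_monoid_mult} \<Rightarrow> ('g free_word \<Rightarrow>\<^sub>0 'r) \<Rightarrow> 'g free_word \<Rightarrow>\<^sub>0 'r"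
  where "scale r \<equiv> Poly_Mapping.map ((*) r)"

lemma scale_add: "scale r (x + y) = scale r x + scale r y"
  and scale_diff: "scale r (x - y) = scale r x - scale r y"
  by (simp_all add: mult_map_scale_conv_mult distrib_left right_diff_distrib)

lemma scale_zero [simp]: "scale r 0 = 0"
  by (simp add: mult_map_scale_conv_mult)

lemma scale_single [simp]: "scale r (Poly_Mapping.single w c) = Poly_Mapping.single w (r * c)"
  by (simp add: map_single)

lemma scale_minus_one: "scale (- 1) x = - x"
  by (rule poly_mapping_eqI) (simp add: map.rep_eq when_def)

lemma keys_scale: "Poly_Mapping.keys (scale r x) \<subseteq> Poly_Mapping.keys x"
  by (auto simp: in_keys_iff map.rep_eq when_def)

lemma free_algebra_simps:
  "\<zero>\<^bsub>free_algebra X\<^esub> = 0" "x \<oplus>\<^bsub>free_algebra X\<^esub> y = x + y" "x \<otimes>\<^bsub>free_algebra X\<^esub> y = x * y"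
  "r \<odot>\<^bsub>free_algebra X\<^esub> x = scale r x"
  by (simp_all add: free_algebra_def)

lemma free_carrier_iff:
  "x \<in> carrier (free_algebra X) \<longleftrightarrow>
    (\<forall>w\<in>Poly_Mapping.keys x. letters w \<noteq> [] \<and> set (letters w) \<subseteq> X)"
  by (simp add: free_algebra_def)

lemma free_carrier_zero: "0 \<in> carrier (free_algebra X)"
  by (simp add: free_carrier_iff)

lemma free_carrier_add:
  "x \<in> carrier (free_algebra X) \<Longrightarrow> y \<in> carrier (free_algebra X) \<Longrightarrow> x + y \<in> carrier (free_algebra X)"
  using keys_add[of x y] unfolding free_carrier_iff by blast

lemma free_carrier_diff:
  "x \<in> carrier (free_algebra X) \<Longrightarrow> y \<in> carrier (free_algebra X) \<Longrightarrow> x - y \<in> carrier (free_algebra X)"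
  using keys_diff[of x y] unfolding free_carrier_iff by blast

lemma free_carrier_mult:
  assumes "x \<in> carrier (free_algebra X)" "y \<in> carrier (free_algebra X)"
  shows "x * y \<in> carrier (free_algebra X)"
  unfolding free_carrier_iff
proof
  fix w
  assume "w \<in> Poly_Mapping.keys (x * y)"
  then obtain u v where "u \<in> Poly_Mapping.keys x" "v \<in> Poly_Mapping.keys y" "w = u + v"
    using keys_mult[of x y] by blast
  then show "letters w \<noteq> [] \<and> set (letters w) \<subseteq> X"
    using assms by (auto simp: free_carrier_iff plus_free_word_def)
qed

lemma free_carrier_scale: "x \<in> carrier (free_algebra X) \<Longrightarrow> scale r x \<in> carrier (free_algebra X)"
  using keys_scale[of r x] unfolding free_carrier_iff by blast

lemma free_carrier_sum:
  "(\<And>i. i \<in> T \<Longrightarrow> x i \<in> carrier (free_algebra X)) \<Longrightarrow> (\<Sum>i\<in>T. x i) \<in> carrier (free_algebra X)"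
  by (induction T rule: infinite_finite_induct) (auto simp: free_carrier_zero free_carrier_add)

lemma free_carrier_gen: "g \<in> X \<Longrightarrow> free_gen g \<in> carrier (free_algebra X)"
  by (simp add: free_carrier_iff free_gen_def)

lemmas free_carrier = free_carrier_zero free_carrier_add free_carrier_diff free_carrier_mult
  free_carrier_scale free_carrier_sum free_carrier_gen

lemma scalars_simps: "carrier scalars = UNIV"
  by (simp add: scalars_def)

lemma algebra_ideal_free_iff:
  "algebra_ideal scalars (free_algebra X) J \<longleftrightarrow>
    J \<subseteq> carrier (free_algebra X) \<and> 0 \<in> J \<and> (\<forall>x\<in>J. \<forall>y\<in>J. x + y \<in> J) \<and> (\<forall>r. \<forall>x\<in>J. scale r x \<in> J) \<and>
    (\<forall>z\<in>carrier (free_algebra X). \<forall>x\<in>J. z * x \<in> J \<and> x * z \<in> J)"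
  (is "?L \<longleftrightarrow> ?R")
proof
  assume ?L
  then have "submodule J scalars (free_algebra X)"
    and "\<forall>z\<in>carrier (free_algebra X). \<forall>x\<in>J. z * x \<in> J \<and> x * z \<in> J"
    by (auto simp: algebra_ideal_def free_algebra_simps)
  then show ?R
    using submodule.smult_closed[of J scalars "free_algebra X"]
      subgroup.subset[of J "add_monoid (free_algebra X)"]
      subgroup.m_closed[of J "add_monoid (free_algebra X)"]
      subgroup.one_closed[of J "add_monoid (free_algebra X)"]
    by (auto simp: submodule_def free_algebra_simps scalars_simps)
next
  assume R: ?R
  have "inv\<^bsub>add_monoid (free_algebra X)\<^esub> x \<in> J" if "x \<in> J" for x
  proof -
    have x: "x \<in> carrier (free_algebra X)" using R that by blast
    have "- x = scale (- 1) x" by (simp add: scale_minus_one)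
    moreover have "inv\<^bsub>add_monoid (free_algebra X)\<^esub> x = - x"
      unfolding m_inv_def
    proof (rule the_equality)
      show "- x \<in> carrier (add_monoid (free_algebra X)) \<and>
          x \<otimes>\<^bsub>add_monoid (free_algebra X)\<^esub> - x = \<one>\<^bsub>add_monoid (free_algebra X)\<^esub> \<and>
          - x \<otimes>\<^bsub>add_monoid (free_algebra X)\<^esub> x = \<one>\<^bsub>add_monoid (free_algebra X)\<^esub>"
        using free_carrier_scale[OF x, of "- 1"] by (simp add: free_algebra_simps scale_minus_one)
      show "y = - x" if "y \<in> carrier (add_monoid (free_algebra X)) \<and>
          x \<otimes>\<^bsub>add_monoid (free_algebra X)\<^esub> y = \<one>\<^bsub>add_monoid (free_algebra X)\<^esub> \<and>
          y \<otimes>\<^bsub>add_monoid (free_algebra X)\<^esub> x = \<one>\<^bsub>add_monoid (free_algebra X)\<^esub>" for y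
        using that by (simp add: free_algebra_simps eq_neg_iff_add_eq_0)
    qed
    ultimately show ?thesis using R that by metis
  qed
  then have "submodule J scalars (free_algebra X)"
    using R by (intro submodule.intro subgroup.intro submodule_axioms.intro)
      (auto simp: free_algebra_simps)
  then show ?L using R by (simp add: algebra_ideal_def free_algebra_simps)
qed

section \<open>The ideal generated by the relations\<close>

context generalized_boolean_dynamical_system
begin

text \<open>The free algebra on the generators, and the ideal generated in it by the relations.\<close>

abbreviation free_alg :: "('l, 'b, 'r::{comm_ring, comm_monoid_mult}) gbds_free set" where
  "free_alg \<equiv> carrier (free_algebra (gbds_gens L \<I>))"

abbreviation rel_ideal :: "('l, 'b, 'r::{comm_ring, comm_monoid_mult}) gbds_free set" where
  "rel_ideal \<equiv> gbds_relation_ideal L \<theta> \<I>"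

lemma gens: "Gen_p A \<in> gbds_gens L \<I>" "\<alpha> \<in> L \<Longrightarrow> B \<in> \<I> \<alpha> \<Longrightarrow> Gen_s \<alpha> B \<in> gbds_gens L \<I>"
  "\<alpha> \<in> L \<Longrightarrow> B \<in> \<I> \<alpha> \<Longrightarrow> Gen_s_star \<alpha> B \<in> gbds_gens L \<I>"
  by (auto simp: gbds_gens_def)

lemma rel_carrier:
  assumes "gbds_rel L \<theta> \<I> x y"
  shows "x - y \<in> free_alg"
  using assms
proof cases
  case (p_regular A)
  then show ?thesis
    by (auto intro!: free_carrier gens theta_ideal simp: Delta_def)
qed (auto intro!: free_carrier gens inf_mem_ideal)

lemma rel_ideal_ideal: "algebra_ideal scalars (free_algebra (gbds_gens L \<I>)) rel_ideal"
proof -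
  have "algebra_ideal scalars (free_algebra (gbds_gens L \<I>)) free_alg"
    unfolding algebra_ideal_free_iff by (auto intro: free_carrier)
  then have "rel_ideal \<subseteq> free_alg"
    unfolding gbds_relation_ideal_def algebra_genideal_def using rel_carrier by blast
  then show ?thesis
    unfolding algebra_ideal_free_iff
    by (auto simp: gbds_relation_ideal_def algebra_genideal_def algebra_ideal_free_iff)
qed

lemma rel_ideal_subset: "rel_ideal \<subseteq> free_alg"
  and rel_ideal_zero: "0 \<in> rel_ideal"
  and rel_ideal_add: "x \<in> rel_ideal \<Longrightarrow> y \<in> rel_ideal \<Longrightarrow> x + y \<in> rel_ideal"
  and rel_ideal_scale: "x \<in> rel_ideal \<Longrightarrow> scale r x \<in> rel_ideal"
  and rel_ideal_left: "z \<in> free_alg \<Longrightarrow> x \<in> rel_ideal \<Longrightarrow> z * x \<in> rel_ideal"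
  and rel_ideal_right: "z \<in> free_alg \<Longrightarrow> x \<in> rel_ideal \<Longrightarrow> x * z \<in> rel_ideal"
  using rel_ideal_ideal unfolding algebra_ideal_free_iff by blast+

lemma rel_ideal_uminus: "x \<in> rel_ideal \<Longrightarrow> - x \<in> rel_ideal"
  using rel_ideal_scale[of x "- 1"] by (simp add: scale_minus_one)

lemma rel_ideal_diff: "x \<in> rel_ideal \<Longrightarrow> y \<in> rel_ideal \<Longrightarrow> x - y \<in> rel_ideal"
  using rel_ideal_add[of x "- y"] rel_ideal_uminus[of y] by simp

lemmas rel_intros = gbds_rel.intros[where L = L and \<theta> = \<theta> and \<I> = \<I>]

lemma rel_ideal_rel: "gbds_rel L \<theta> \<I> x y \<Longrightarrow> x - y \<in> rel_ideal"
  unfolding gbds_relation_ideal_def algebra_genideal_def by blast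

lemma rel_ideal_rel_scale: "gbds_rel L \<theta> \<I> x y \<Longrightarrow> scale r x - scale r y \<in> rel_ideal"
  using rel_ideal_scale[OF rel_ideal_rel] by (simp add: scale_diff)

lemma rel_ideal_rel_sym: "gbds_rel L \<theta> \<I> x y \<Longrightarrow> scale r y - scale r x \<in> rel_ideal"
  using rel_ideal_uminus[OF rel_ideal_rel_scale] by simp

lemma rel_ideal_minimal:
  "algebra_ideal scalars (free_algebra (gbds_gens L \<I>)) N \<Longrightarrow>
    (\<And>x y. gbds_rel L \<theta> \<I> x y \<Longrightarrow> x - y \<in> N) \<Longrightarrow> rel_ideal \<subseteq> N"
  unfolding gbds_relation_ideal_def algebra_genideal_def by blast

lemma scale_gen: "scale r (free_gen g) = Poly_Mapping.single (Word [g]) r"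
  by (simp add: free_gen_def)

text \<open>The element \<open>r p\<^sub>A\<close> of the free algebra.\<close>

definition scaled_p :: "'r::{comm_ring, comm_monoid_mult} \<Rightarrow> 'b \<Rightarrow> ('l, 'b, 'r) gbds_free" where
  "scaled_p r A = scale r (free_p A)"

lemma scaled_p_single: "Poly_Mapping.single (Word [Gen_p A]) r = scaled_p r A"
  by (simp add: scaled_p_def scale_gen)

lemma scaled_p_one: "scaled_p 1 A = free_p A"
  by (simp add: scaled_p_def free_gen_def)

lemma gbds_congruence_rel_ideal:
  "gbds_congruence L \<theta> \<I> free_alg rel_ideal (scaled_p :: 'r::{comm_ring, comm_monoid_mult} \<Rightarrow> _) free_s free_s_star"
proof
  fix r r' :: 'r and A A' :: 'b
  show "scaled_p r A \<in> free_alg"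
    unfolding scaled_p_def by (intro free_carrier gens)
  show "scaled_p 0 A = 0"
    by (simp add: scaled_p_def scale_gen)
  show "scaled_p (r + r') A = scaled_p r A + scaled_p r' A"
    by (simp add: scaled_p_def scale_gen single_add)
  show "scaled_p r bot \<in> rel_ideal"
    using rel_ideal_rel_scale[OF rel_intros(1)] by (simp add: scaled_p_def)
  have "scaled_p r A * scaled_p r' A' = scale (r * r') (free_p A * free_p A')"
    by (simp add: scaled_p_def free_gen_def mult_single)
  then show "scaled_p r A * scaled_p r' A' - scaled_p (r * r') (inf A A') \<in> rel_ideal"
    using rel_ideal_rel_sym[OF rel_intros(2)] by (simp add: scaled_p_def)
  show "scaled_p r (sup A A') - (scaled_p r A + scaled_p r A' - scaled_p r (inf A A')) \<in> rel_ideal"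
    using rel_ideal_rel_scale[OF rel_intros(3)] by (simp add: scaled_p_def scale_add scale_diff)
next
  fix r :: 'r and A and \<alpha> B
  assume ab: "\<alpha> \<in> L" "B \<in> \<I> \<alpha>"
  show "scaled_p r A * free_s \<alpha> B - free_s \<alpha> B * scaled_p r (\<theta> \<alpha> A) \<in> rel_ideal"
    using rel_ideal_rel_scale[OF rel_intros(4)[OF ab], of r] by (simp add: scaled_p_def free_gen_def mult_single)
  show "free_s_star \<alpha> B * scaled_p r A - scaled_p r (\<theta> \<alpha> A) * free_s_star \<alpha> B \<in> rel_ideal"
    using rel_ideal_rel_scale[OF rel_intros(5)[OF ab], of r] by (simp add: scaled_p_def free_gen_def mult_single)
next
  fix \<alpha> B B'
  assume ab: "\<alpha> \<in> L" "B \<in> \<I> \<alpha>"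
  show "free_s \<alpha> B * scaled_p 1 B' - free_s \<alpha> (inf B B') \<in> rel_ideal"
    using rel_ideal_rel[OF rel_intros(7)[OF ab]] by (simp add: scaled_p_one)
  show "scaled_p 1 B' * free_s_star \<alpha> B - free_s_star \<alpha> (inf B B') \<in> rel_ideal"
    using rel_ideal_rel[OF rel_intros(8)[OF ab]] by (simp add: scaled_p_one)
next
  fix \<alpha> B B'
  assume "\<alpha> \<in> L" "B \<in> \<I> \<alpha>" "B' \<in> \<I> \<alpha>"
  then show "free_s_star \<alpha> B * free_s \<alpha> B' - scaled_p 1 (inf B B') \<in> rel_ideal"
    using rel_ideal_rel[OF rel_intros(6)[of \<alpha> B \<alpha> B']] by (simp add: scaled_p_one)
next
  fix \<alpha> B \<alpha>' B'
  assume "\<alpha> \<in> L" "B \<in> \<I> \<alpha>" "\<alpha>' \<in> L" "B' \<in> \<I> \<alpha>'" "\<alpha> \<noteq> \<alpha>'"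
  then show "free_s_star \<alpha> B * free_s \<alpha>' B' \<in> rel_ideal"
    using rel_ideal_rel[OF rel_intros(6)[of \<alpha> B \<alpha>' B']] by simp
next
  fix A
  assume "A \<in> regular_elements L \<theta>"
  then show "scaled_p 1 A - (\<Sum>\<alpha>\<in>Delta L \<theta> A. free_s \<alpha> (\<theta> \<alpha> A) * free_s_star \<alpha> (\<theta> \<alpha> A)) \<in> rel_ideal"
    using rel_ideal_rel[OF rel_intros(9)] by (simp add: scaled_p_one)
qed (use rel_ideal_subset rel_ideal_zero rel_ideal_add rel_ideal_diff rel_ideal_left rel_ideal_right in \<open>auto intro: free_carrier gens\<close>)

text \<open>
  A word of length one other than \<open>p\<^sub>A\<close> becomes a monomial by inserting a factor \<open>p\<^sub>B\<close>, as
  \<open>s\<^sub>\<alpha>\<^sub>,\<^sub>B p\<^sub>B = s\<^sub>\<alpha>\<^sub>,\<^sub>B\<close>.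
\<close>

lemma word_cong_monomial:
  fixes r :: "'r::{comm_ring, comm_monoid_mult}"
  assumes "w \<noteq> []" "set w \<subseteq> gbds_gens L \<I>"
  shows "\<exists>m\<in>gbds_congruence.homogeneous_monomials L \<I> (scaled_p :: 'r \<Rightarrow> _) free_s free_s_star (word_degree (Word w)).
      Poly_Mapping.single (Word w) r - m \<in> rel_ideal"
proof -
  interpret gbds_congruence L \<theta> \<I> free_alg rel_ideal "scaled_p :: 'r \<Rightarrow> _" free_s free_s_star
    by (rule gbds_congruence_rel_ideal)
  have "\<exists>m\<in>homogeneous_monomials (word_degree (Word w)). cong (Poly_Mapping.single (Word w) r) m"
    using assms
  proof (induction w rule: list_nonempty_induct)
    case (single g)
    then consider A where "g = Gen_p A" | \<alpha> B where "g = Gen_s \<alpha> B" "\<alpha> \<in> L" "B \<in> \<I> \<alpha>"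
      | \<alpha> B where "g = Gen_s_star \<alpha> B" "\<alpha> \<in> L" "B \<in> \<I> \<alpha>"
      by (auto simp: gbds_gens_def)
    then show ?case
    proof cases
      case (1 A)
      have "scaled_p r A \<in> homogeneous_monomials 0"
        unfolding homogeneous_monomials_def using monomial.q by fastforce
      then show ?thesis
        using 1 cong_refl[of "scaled_p r A"]
        by (intro bexI[of _ "scaled_p r A"]) (simp_all add: word_degree_def scaled_p_single)
    next
      case (2 \<alpha> B)
      have "monomial (Suc 0) 0 (free_s \<alpha> B * scaled_p r B)"
        using 2 by (intro monomial.intros)
      then have "free_s \<alpha> B * scaled_p r B \<in> homogeneous_monomials 1"
        unfolding homogeneous_monomials_def by fastforce
      moreover have "cong (Poly_Mapping.single (Word [g]) r) (free_s \<alpha> B * scaled_p r B)"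
        using rel_ideal_rel_sym[OF rel_intros(7)[OF 2(2,3)], of r B] 2(1)
        by (simp add: cong_def scaled_p_def free_gen_def mult_single)
      ultimately show ?thesis using 2(1) by (auto simp: word_degree_def)
    next
      case (3 \<alpha> B)
      have "monomial 0 (Suc 0) (scaled_p r B * free_s_star \<alpha> B)"
        using 3 by (intro monomial.intros)
      then have "scaled_p r B * free_s_star \<alpha> B \<in> homogeneous_monomials (- 1)"
        unfolding homogeneous_monomials_def by fastforce
      moreover have "cong (Poly_Mapping.single (Word [g]) r) (scaled_p r B * free_s_star \<alpha> B)"
        using rel_ideal_rel_sym[OF rel_intros(8)[OF 3(2,3)], of r B] 3(1)
        by (simp add: cong_def scaled_p_def free_gen_def mult_single)
      ultimately show ?thesis using 3(1) by (auto simp: word_degree_def)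
    qed
  next
    case (cons g w)
    then obtain m where m: "m \<in> homogeneous_monomials (word_degree (Word w))" "cong (Poly_Mapping.single (Word w) r) (m)"
      by auto
    have "Poly_Mapping.single (Word (g # w)) r = free_gen g * Poly_Mapping.single (Word w) r"
      by (simp add: free_gen_def mult_single plus_free_word_def)
    also have "cong \<dots> (free_gen g * m)"
      using cons.prems m(2) by (intro cong_left free_carrier) auto
    finally have *: "cong (Poly_Mapping.single (Word (g # w)) r) (free_gen g * m)" .
    have deg: "word_degree (Word (g # w)) = word_degree (Word w) + gen_degree g"
      by (simp add: word_degree_def)
    consider A where "g = Gen_p A" | \<alpha> B where "g = Gen_s \<alpha> B" "\<alpha> \<in> L" "B \<in> \<I> \<alpha>"
      | \<alpha> B where "g = Gen_s_star \<alpha> B" "\<alpha> \<in> L" "B \<in> \<I> \<alpha>"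
      using cons.prems by (auto simp: gbds_gens_def)
    then have "\<exists>m'\<in>homogeneous_monomials (word_degree (Word (g # w))). cong (free_gen g * m) m'"
    proof cases
      case (1 A)
      then show ?thesis using homogeneous_monomials_q[OF m(1), of A] deg by (simp add: scaled_p_one)
    next
      case (2 \<alpha> B)
      then show ?thesis using homogeneous_monomials_s[OF m(1), of \<alpha> B] deg cong_refl by auto
    next
      case (3 \<alpha> B)
      then show ?thesis using homogeneous_monomials_t[OF m(1), of \<alpha> B] deg by simp
    qed
    then show ?case using * cong_trans by blast
  qed
  then show ?thesis by (simp add: cong_def)
qed

text \<open>The kernel of the representation is an ideal that contains the relations but not \<open>r p\<^sub>A\<close>.\<close>

lemma scaled_p_not_mem_rel_ideal:
  fixes r :: "'r::{comm_ring, comm_monoid_mult}"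
  assumes "r \<noteq> 0" "A \<noteq> bot"
  shows "scaled_p r A \<notin> rel_ideal"
proof -
  obtain D :: "('b \<Rightarrow> bool) \<times> ('l \<times> ('b \<Rightarrow> bool) + nat) \<Rightarrow> 'b \<Rightarrow> bool" and e
    where "gbds_branching L \<theta> \<I> D e" and D: "\<And>A. A \<noteq> bot \<Longrightarrow> \<exists>y. D y A"
    using branching_exists by (elim exE conjE) auto
  then interpret gbds_branching L \<theta> \<I> D e by simp
  let ?N = "{x \<in> free_alg. \<forall>h y. rep x h y = (0::'r)}"
  have "rep (0 :: ('l, 'b, 'r) gbds_free) (\<lambda>y. 0) = (\<lambda>y. 0)"
    by (simp add: rep_0 fun_eq_iff)
  then have rep_const: "rep x (\<lambda>y. 0) y = 0" for x :: "('l, 'b, 'r) gbds_free" and y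
    using rep_mult[of x 0 "\<lambda>y. 0" y] by (simp add: rep_0)
  have "algebra_ideal scalars (free_algebra (gbds_gens L \<I>)) ?N"
    unfolding algebra_ideal_free_iff
  proof (intro conjI ballI allI)
    fix z x :: "('l, 'b, 'r) gbds_free"
    assume z: "z \<in> free_alg" and x: "x \<in> ?N"
    then have "rep x h = (\<lambda>y. 0)" for h by (simp add: fun_eq_iff)
    then show "z * x \<in> ?N" "x * z \<in> ?N"
      using z x by (auto intro: free_carrier simp: rep_mult rep_const)
  qed (auto intro: free_carrier simp: rep_0 rep_add rep_scale)
  moreover have "x - x' \<in> ?N" if "gbds_rel L \<theta> \<I> x x'" for x x' :: "('l, 'b, 'r) gbds_free"
    using rel_carrier[OF that] rep_rel[OF that] by (simp add: rep_diff)
  ultimately have "rel_ideal \<subseteq> ?N" by (rule rel_ideal_minimal)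
  moreover obtain y where "D y A" using D assms(2) by blast
  then have "rep (scaled_p r A) (\<lambda>y. 1) y \<noteq> 0"
    using assms(1) by (simp add: scaled_p_def rep_scale rep_gen)
  ultimately show ?thesis by blast
qed

section \<open>Computing in the quotient\<close>

text \<open>The quotient map.\<close>

abbreviation cls :: "('l, 'b, 'r::{comm_ring, comm_monoid_mult}) gbds_free \<Rightarrow> ('l, 'b, 'r) gbds_free set" where
  "cls \<equiv> gbds_class L \<theta> \<I>"

lemma cls_eq: "cls x = {y. y - x \<in> rel_ideal}"
proof
  show "cls x \<subseteq> {y. y - x \<in> rel_ideal}"
    by (auto simp: gbds_class_def a_r_coset_def' free_algebra_simps)
  show "{y. y - x \<in> rel_ideal} \<subseteq> cls x"
  proof
    fix y
    assume "y \<in> {y. y - x \<in> rel_ideal}"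
    then show "y \<in> cls x"
      by (auto simp: gbds_class_def a_r_coset_def' free_algebra_simps intro!: bexI[of _ "y - x"])
  qed
qed

lemma mem_cls_self: "x \<in> cls x"
  by (simp add: cls_eq rel_ideal_zero)

lemma cls_eq_iff: "cls x = cls y \<longleftrightarrow> x - y \<in> rel_ideal"
proof
  assume "cls x = cls y"
  then have "x \<in> cls y" using mem_cls_self by metis
  then show "x - y \<in> rel_ideal" by (simp add: cls_eq)
next
  assume xy: "x - y \<in> rel_ideal"
  have "z - x \<in> rel_ideal \<longleftrightarrow> z - y \<in> rel_ideal" for z
  proof
    show "z - y \<in> rel_ideal" if "z - x \<in> rel_ideal" using rel_ideal_add[OF that xy] by simp
    show "z - x \<in> rel_ideal" if "z - y \<in> rel_ideal" using rel_ideal_diff[OF that xy] by simp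
  qed
  then show "cls x = cls y" by (simp add: cls_eq)
qed

lemma gbds_algebra_carrier: "carrier (gbds_algebra L \<theta> \<I>) = cls ` free_alg"
  by (auto simp: gbds_algebra_def quotient_algebra_def A_RCOSETS_def' gbds_class_def)

lemma gbds_algebra_add: "cls x \<oplus>\<^bsub>gbds_algebra L \<theta> \<I>\<^esub> cls y = cls (x + y)"
proof -
  have "cls x \<oplus>\<^bsub>gbds_algebra L \<theta> \<I>\<^esub> cls y = {a + b |a b. a \<in> cls x \<and> b \<in> cls y}"
    by (auto simp: gbds_algebra_def quotient_algebra_def set_add_def' free_algebra_simps)
  also have "\<dots> = cls (x + y)"
  proof
    show "{a + b |a b. a \<in> cls x \<and> b \<in> cls y} \<subseteq> cls (x + y)"
    proof clarify
      fix a b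
      assume "a \<in> cls x" "b \<in> cls y"
      then show "a + b \<in> cls (x + y)"
        using rel_ideal_add[of "a - x" "b - y"] by (simp add: cls_eq algebra_simps)
    qed
    show "cls (x + y) \<subseteq> {a + b |a b. a \<in> cls x \<and> b \<in> cls y}"
    proof
      fix z
      assume "z \<in> cls (x + y)"
      then have "z - y \<in> cls x" by (simp add: cls_eq algebra_simps)
      then show "z \<in> {a + b |a b. a \<in> cls x \<and> b \<in> cls y}"
        using mem_cls_self[of y] by (intro CollectI exI[of _ "z - y"] exI[of _ y]) simp
    qed
  qed
  finally show ?thesis .
qed

lemma gbds_algebra_mult:
  assumes "x \<in> free_alg" "y \<in> free_alg"
  shows "cls x \<otimes>\<^bsub>gbds_algebra L \<theta> \<I>\<^esub> cls y = cls (x * y)"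
proof -
  have "cls (a * b) = cls (x * y)" if "a \<in> cls x" "b \<in> cls y" for a b
  proof -
    have ab: "a - x \<in> rel_ideal" "b - y \<in> rel_ideal" using that by (auto simp: cls_eq)
    then have "a \<in> free_alg" using free_carrier_add[of "a - x"] rel_ideal_subset assms by fastforce
    then have "a * (b - y) + (a - x) * y \<in> rel_ideal"
      using ab assms by (intro rel_ideal_add rel_ideal_left rel_ideal_right)
    then show ?thesis by (simp add: cls_eq_iff algebra_simps)
  qed
  then have "(\<Union>a\<in>cls x. \<Union>b\<in>cls y. cls (a * b)) = (\<Union>a\<in>cls x. \<Union>b\<in>cls y. cls (x * y))"
    by (intro SUP_cong refl)
  also have "\<dots> = cls (x * y)"
    using mem_cls_self by (auto simp only: UN_constant split: if_splits)
  moreover have "cls x \<otimes>\<^bsub>gbds_algebra L \<theta> \<I>\<^esub> cls y = (\<Union>a\<in>cls x. \<Union>b\<in>cls y. cls (a * b))"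
    by (simp add: gbds_algebra_def quotient_algebra_def rcoset_mult_def free_algebra_simps
        gbds_class_def)
  ultimately show ?thesis by simp
qed

lemma gbds_algebra_smult: "r \<odot>\<^bsub>gbds_algebra L \<theta> \<I>\<^esub> cls x = cls (scale r x)"
proof -
  have "cls (scale r a) = cls (scale r x)" if "a \<in> cls x" for a
  proof -
    have "a - x \<in> rel_ideal" using that by (simp add: cls_eq)
    then show ?thesis using rel_ideal_scale[of "a - x" r] by (simp add: cls_eq_iff scale_diff)
  qed
  then have "(\<Union>a\<in>cls x. cls (scale r a)) = (\<Union>a\<in>cls x. cls (scale r x))"
    by (intro SUP_cong refl)
  also have "\<dots> = cls (scale r x)"
    using mem_cls_self by (auto simp only: UN_constant split: if_splits)
  moreover have "r \<odot>\<^bsub>gbds_algebra L \<theta> \<I>\<^esub> cls x = (\<Union>a\<in>cls x. cls (scale r a))"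
    by (simp add: gbds_algebra_def quotient_algebra_def free_algebra_simps gbds_class_def)
  ultimately show ?thesis by simp
qed

section \<open>Homogeneous components\<close>

text \<open>The homogeneous component of degree \<open>n\<close>.\<close>

definition degree_part :: "int \<Rightarrow> ('l, 'b, 'r::{comm_ring, comm_monoid_mult}) gbds_free \<Rightarrow> ('l, 'b, 'r) gbds_free" where
  "degree_part n x = (\<Sum>w | w \<in> Poly_Mapping.keys x \<and> word_degree w = n.
     Poly_Mapping.single w (Poly_Mapping.lookup x w))"

lemma degree_part_keys: "w \<in> Poly_Mapping.keys (degree_part n x) \<Longrightarrow> w \<in> Poly_Mapping.keys x \<and> word_degree w = n"
  unfolding degree_part_def
  by (auto simp: in_keys_iff lookup_sum lookup_single when_def split: if_splits)

lemma degree_part_carrier: "x \<in> free_alg \<Longrightarrow> degree_part n x \<in> free_alg"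
  using degree_part_keys unfolding free_carrier_iff by blast

lemma degree_part_sum: "x = (\<Sum>n\<in>word_degree ` Poly_Mapping.keys x. degree_part n x)"
proof -
  have "(\<Sum>n\<in>word_degree ` Poly_Mapping.keys x. degree_part n x)
      = (\<Sum>w\<in>Poly_Mapping.keys x. Poly_Mapping.single w (Poly_Mapping.lookup x w))"
    unfolding degree_part_def by (rule sum.group) auto
  then show ?thesis using poly_mapping_expand[of x] by simp
qed

lemma degree_part_mem_grading: "x \<in> free_alg \<Longrightarrow> cls (degree_part n x) \<in> gbds_grading L \<theta> \<I> n"
  unfolding gbds_grading_def using degree_part_carrier degree_part_keys by blast

end

theorem theorem5p3:
  fixes L :: "'l set"
    and \<theta> :: "'l \<Rightarrow> 'b::generalized_boolean_algebra \<Rightarrow> 'b"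
    and \<I> :: "'l \<Rightarrow> 'b set"
    and \<A> :: "('r::{comm_ring, comm_monoid_mult}, 'a) module"
    and G :: "int \<Rightarrow> 'a set"
    and f :: "('l, 'b, 'r) gbds_free set \<Rightarrow> 'a"
  assumes "generalized_boolean_dynamical_system L \<theta> \<I>"
    and "Z_graded_algebra scalars \<A> G"
    and "Z_graded_hom scalars (gbds_algebra L \<theta> \<I>) (gbds_grading L \<theta> \<I>) \<A> G f"
  shows "inj_on f (carrier (gbds_algebra L \<theta> \<I>)) \<longleftrightarrow>
    (\<forall>A r. A \<noteq> bot \<longrightarrow> r \<noteq> 0 \<longrightarrow>
       f (r \<odot>\<^bsub>gbds_algebra L \<theta> \<I>\<^esub> gbds_p L \<theta> \<I> A) \<noteq> \<zero>\<^bsub>\<A>\<^esub>)"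
proof -
  interpret generalized_boolean_dynamical_system L \<theta> \<I> by fact
  interpret A: Z_graded_algebra scalars \<A> G by fact
  let ?M = "gbds_algebra L \<theta> \<I> :: ('r, ('l, 'b, 'r) gbds_free set) module"
  let ?q = "scaled_p :: 'r \<Rightarrow> 'b \<Rightarrow> ('l, 'b, 'r) gbds_free"
  interpret gbds_congruence L \<theta> \<I> free_alg rel_ideal ?q free_s free_s_star
    by (rule gbds_congruence_rel_ideal)
  \<comment> \<open>The composition of \<open>f\<close> with the quotient map of the free algebra.\<close>
  define F where "F x = f (cls x)" for x
  have clsM: "cls x \<in> carrier ?M" if "x \<in> free_alg" for x
    using that by (auto simp: gbds_algebra_carrier)
  have hom: "algebra_hom scalars ?M \<A> f" and graded: "f ` gbds_grading L \<theta> \<I> n \<subseteq> G n" for n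
    using assms(3) by (auto simp: Z_graded_hom_def)
  have F_carrier: "F x \<in> carrier \<A>" if "x \<in> free_alg" for x
    using hom clsM[OF that] by (auto simp: algebra_hom_def F_def)
  have F_add: "F (x + y) = F x \<oplus>\<^bsub>\<A>\<^esub> F y" if "x \<in> free_alg" "y \<in> free_alg" for x y
    using hom clsM that by (simp add: algebra_hom_def F_def flip: gbds_algebra_add)
  have F_mult: "F (x * y) = F x \<otimes>\<^bsub>\<A>\<^esub> F y" if "x \<in> free_alg" "y \<in> free_alg" for x y
    using hom clsM that by (simp add: algebra_hom_def F_def flip: gbds_algebra_mult)
  have F_scale: "F (scale r x) = r \<odot>\<^bsub>\<A>\<^esub> F x" if "x \<in> free_alg" for r x
    using hom clsM that by (simp add: algebra_hom_def F_def scalars_simps flip: gbds_algebra_smult)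
  have F_0: "F 0 = \<zero>\<^bsub>\<A>\<^esub>"
    using F_scale[OF free_carrier_zero, of 0] A.smult_l_null[OF F_carrier[OF free_carrier_zero]]
    by (simp add: scalars_def)
  have F_rel_ideal: "F x = \<zero>\<^bsub>\<A>\<^esub>" if "x \<in> rel_ideal" for x
    using cls_eq_iff[of x 0] that F_0 by (simp add: F_def)
  have F_diff: "F (x - y) = \<zero>\<^bsub>\<A>\<^esub>" if "x \<in> free_alg" "y \<in> free_alg" "F x = F y" for x y
  proof -
    have "F (x - y) = F x \<oplus>\<^bsub>\<A>\<^esub> F (scale (- 1) y)"
      using F_add[OF that(1) free_carrier_scale[OF that(2), of "- 1"]] by (simp add: scale_minus_one)
    also have "\<dots> = F x \<oplus>\<^bsub>\<A>\<^esub> F (scale (- 1) x)"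
      using that by (simp only: F_scale)
    also have "\<dots> = F (x - x)"
      using F_add[OF that(1) free_carrier_scale[OF that(1), of "- 1"]] by (simp add: scale_minus_one)
    finally show ?thesis by (simp add: F_0)
  qed
  have F_sum: "F (\<Sum>i\<in>S. x i) = (\<Oplus>\<^bsub>\<A>\<^esub>i\<in>S. F (x i))"
    if "finite S" "\<And>i. x i \<in> free_alg" for S and x :: "int \<Rightarrow> ('l, 'b, 'r) gbds_free"
    using that(1)
  proof (induction S)
    case (insert n S)
    then have "F (\<Sum>i\<in>insert n S. x i) = F (x n) \<oplus>\<^bsub>\<A>\<^esub> F (\<Sum>i\<in>S. x i)"
      using that(2) by (simp add: F_add free_carrier_sum)
    then show ?case
      using insert that(2) F_carrier by (simp add: A.M.finsum_insert)
  qed (simp add: F_0)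
  have gbds_p: "r \<odot>\<^bsub>?M\<^esub> gbds_p L \<theta> \<I> A = cls (scaled_p r A)" for r A
    by (simp add: gbds_p_def gbds_algebra_smult scaled_p_def)
  show ?thesis
  proof (intro iffI allI impI)
    fix A :: 'b and r :: 'r
    assume inj: "inj_on f (carrier ?M)" and Ar: "A \<noteq> bot" "r \<noteq> 0"
    have "F (scaled_p r A) \<noteq> F 0"
    proof
      assume "F (scaled_p r A) = F 0"
      then have "cls (scaled_p r A) = cls 0"
        using inj_onD[OF inj _ clsM[OF q_C] clsM[OF free_carrier_zero]] by (simp add: F_def)
      then show False
        using cls_eq_iff[of "scaled_p r A" 0] scaled_p_not_mem_rel_ideal[OF Ar(2,1)] by simp
    qed
    then show "f (r \<odot>\<^bsub>?M\<^esub> gbds_p L \<theta> \<I> A) \<noteq> \<zero>\<^bsub>\<A>\<^esub>"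
      by (simp add: gbds_p F_def[symmetric] F_0)
  next
    assume nz: "\<forall>A r. A \<noteq> bot \<longrightarrow> r \<noteq> 0 \<longrightarrow> f (r \<odot>\<^bsub>?M\<^esub> gbds_p L \<theta> \<I> A) \<noteq> \<zero>\<^bsub>\<A>\<^esub>"
    let ?K = "{x \<in> free_alg. F x = \<zero>\<^bsub>\<A>\<^esub>}"
    interpret gbds_faithful_ideal L \<theta> \<I> free_alg rel_ideal ?q free_s free_s_star ?K
    proof
      show "rel_ideal \<subseteq> ?K" using rel_ideal_subset F_rel_ideal by blast
      show "x - y \<in> ?K" if "x \<in> ?K" "y \<in> ?K" for x y
        using that F_diff free_carrier_diff by auto
      fix z x :: "('l, 'b, 'r) gbds_free"
      assume zx: "z \<in> free_alg" "x \<in> ?K"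
      have F0: "F z \<otimes>\<^bsub>\<A>\<^esub> \<zero>\<^bsub>\<A>\<^esub> = \<zero>\<^bsub>\<A>\<^esub>" "\<zero>\<^bsub>\<A>\<^esub> \<otimes>\<^bsub>\<A>\<^esub> F z = \<zero>\<^bsub>\<A>\<^esub>"
        using F_mult[OF zx(1) free_carrier_zero] F_mult[OF free_carrier_zero zx(1)] F_0 by simp_all
      show "z * x \<in> ?K" "x * z \<in> ?K"
        using zx F0 by (simp_all add: F_mult free_carrier_mult)
    next
      fix r :: 'r and A :: 'b
      assume "r \<noteq> 0" "A \<noteq> bot"
      then show "scaled_p r A \<notin> ?K" using nz by (auto simp: gbds_p F_def)
    qed
    have ker: "x \<in> rel_ideal" if x: "x \<in> free_alg" "F x = \<zero>\<^bsub>\<A>\<^esub>" for x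
    proof -
      define S where "S = word_degree ` Poly_Mapping.keys x"
      define c where "c n = F (degree_part n x)" for n
      have c_G: "c n \<in> G n" for n
        using degree_part_mem_grading[OF x(1)] graded by (auto simp: c_def F_def)
      have S: "finite S" "{n. c n \<noteq> \<zero>\<^bsub>\<A>\<^esub>} \<subseteq> S"
      proof -
        have "degree_part n x = 0" if "n \<notin> S" for n
          unfolding degree_part_def using that by (intro sum.neutral) (auto simp: S_def)
        then have "c n = \<zero>\<^bsub>\<A>\<^esub>" if "n \<notin> S" for n
          using that F_0 by (simp add: c_def)
        then show "{n. c n \<noteq> \<zero>\<^bsub>\<A>\<^esub>} \<subseteq> S" by blast
      qed (simp add: S_def)
      have "\<zero>\<^bsub>\<A>\<^esub> = F (\<Sum>n\<in>S. degree_part n x)"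
        using x(2) degree_part_sum[of x] by (simp add: S_def)
      also have "\<dots> = (\<Oplus>\<^bsub>\<A>\<^esub>n\<in>S. c n)"
        using F_sum[OF S(1)] degree_part_carrier[OF x(1)] by (simp add: c_def)
      also have "\<dots> = (\<Oplus>\<^bsub>\<A>\<^esub>n\<in>{n. c n \<noteq> \<zero>\<^bsub>\<A>\<^esub>}. c n)"
        using S F_carrier degree_part_carrier[OF x(1)]
        by (intro A.M.add.finprod_mono_neutral_cong_left[symmetric]) (auto simp: c_def)
      finally have c_sum: "\<zero>\<^bsub>\<A>\<^esub> = (\<Oplus>\<^bsub>\<A>\<^esub>n\<in>{n. c n \<noteq> \<zero>\<^bsub>\<A>\<^esub>}. c n)" .
      have zero_G: "\<zero>\<^bsub>\<A>\<^esub> \<in> G n" for n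
        using subgroup.one_closed[of "G n" "add_monoid \<A>"] A.graded_submodule[of n]
        by (simp add: submodule_def)
      let ?P = "\<lambda>c. (\<forall>n. c n \<in> G n) \<and> finite {n. c n \<noteq> \<zero>\<^bsub>\<A>\<^esub>} \<and>
          \<zero>\<^bsub>\<A>\<^esub> = (\<Oplus>\<^bsub>\<A>\<^esub>n\<in>{n. c n \<noteq> \<zero>\<^bsub>\<A>\<^esub>}. c n)"
      \<comment> \<open>The components of \<open>F x\<close> and the zero family both decompose zero.\<close>
      have P: "?P c" "?P (\<lambda>n. \<zero>\<^bsub>\<A>\<^esub>)"
        using c_G c_sum finite_subset[OF S(2,1)] zero_G by simp_all
      have "\<exists>!c. ?P c" by (rule A.graded_decomposition[OF A.M.zero_closed])
      then obtain c' where all: "\<forall>c. ?P c \<longrightarrow> c = c'"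
        by (elim ex1E) (rule that)
      have c': "c = c'" if "?P c" for c
        by (rule mp[OF spec[of "\<lambda>c. ?P c \<longrightarrow> c = c'" c, OF all] that])
      have "c = (\<lambda>n. \<zero>\<^bsub>\<A>\<^esub>)" using c'[OF P(1)] c'[OF P(2)] by simp
      then have part_K: "degree_part n x \<in> ?K" for n
        using degree_part_carrier[OF x(1)] by (simp add: c_def fun_eq_iff)
      have "degree_part n x \<in> rel_ideal" for n
      proof -
        obtain ws where ws: "set ws = {w \<in> Poly_Mapping.keys x. word_degree w = n}" "distinct ws"
          using finite_distinct_list[of "{w \<in> Poly_Mapping.keys x. word_degree w = n}"] by auto
        let ?g = "\<lambda>w. Poly_Mapping.single w (Poly_Mapping.lookup x w)"
        have "\<exists>m. m \<in> homogeneous_monomials n \<and> cong (?g w) m" if "w \<in> set ws" for w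
        proof (cases w)
          case (Word u)
          have "w \<in> Poly_Mapping.keys x" using that ws(1) by simp
          then have "letters w \<noteq> [] \<and> set (letters w) \<subseteq> gbds_gens L \<I>"
            using x(1) unfolding free_carrier_iff by blast
          then have "u \<noteq> []" "set u \<subseteq> gbds_gens L \<I>"
            using Word by simp_all
          then show ?thesis
            using word_cong_monomial[of u "Poly_Mapping.lookup x w"] that ws(1) Word
            by (auto simp: cong_def)
        qed
        then obtain ms where ms: "\<forall>m\<in>set ms. m \<in> homogeneous_monomials n" "cong (sum_list (map ?g ws)) (sum_list ms)"
          using cong_sum_list_ex[of ws "\<lambda>m. m \<in> homogeneous_monomials n" ?g] by blast
        have "degree_part n x = sum_list (map ?g ws)"
          using ws by (simp add: degree_part_def sum_list_distinct_conv_sum_set)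
        then show ?thesis
          using homogeneous_mem_J[OF part_K, of n ms] ms by auto
      qed
      then have "(\<Sum>n\<in>T. degree_part n x) \<in> rel_ideal" for T
        by (induction T rule: infinite_finite_induct) (auto simp: rel_ideal_zero rel_ideal_add)
      then show ?thesis using degree_part_sum[of x] by metis
    qed
    show "inj_on f (carrier ?M)"
      unfolding gbds_algebra_carrier
    proof (rule inj_onI, clarify)
      fix x y
      assume xy: "x \<in> free_alg" "y \<in> free_alg" and "f (cls x) = f (cls y)"
      then have "F (x - y) = \<zero>\<^bsub>\<A>\<^esub>" by (intro F_diff) (simp_all add: F_def)
      then have "x - y \<in> rel_ideal" by (intro ker free_carrier_diff xy)
      then show "cls x = cls y" by (simp add: cls_eq_iff)
    qed
  qed
qed

end
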